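(* Let $e,u,v,q$ be complex parameters (generic, so no denominator vanishes) with $e\neq 1/q$. Let $K_2(n):=K(q,q^{-n},q^{1-n},q^{2-n},e,u,v,q^3)$ and put \[ A_r:=\frac{(e,q^3u,q^3v,q^4/u,q^4/v;q^3)_r}{(q^4/e,u,v,q/u,q/v;q^3)_r\,e^r},\qquad B_r:=\frac{(e/q,q^2u,q^2v,q^3/u,q^3/v;q^3)_r}{(q^3/e,u/q,v/q,1/u,1/v;q^3)_r\,e^r}. \] (i) The sequences with $\alpha_0=\beta_0=1$, and \[ \alpha_{3r}=(-1)^r\big(q^{\frac{9r^2-11r}{2}}A_r+q^{\frac{9r^2-5r}{2}}B_r\big)\ (r\ge1),\quad \alpha_{3r+1}=(-1)^{r+1}q^{\frac{9r^2+r}{2}+1}A_r\ (r\ge0),\quad \alpha_{3r-1}=(-1)^{r+1}q^{\frac{9r^2-17r}{2}+1}B_r\ (r\ge1), \] \[ \beta_n=K_2(n)\frac{(q^2/e;q^3)_n}{(q;q)_{2n}(q^2/e;q)_n}, \] form a Bailey pair relative to $a=1$. (ii) The sequences with $\alpha_0=\beta_0=1$, and \[ \alpha_{3r}=(-1)^r\big(q^{\frac{9r^2-5r}{2}}A_r+q^{\frac{9r^2-11r}{2}}B_r\big)\ (r\ge1),\quad \alpha_{3r+1}=(-1)^{r+1}q^{\frac{9r^2-5r}{2}}A_r\ (r\ge0),\quad \alpha_{3r-1}=(-1)^{r+1}q^{\frac{9r^2-11r}{2}}B_r\ (r\ge1), \] \[ \beta_n=K_2(n)\frac{(q^2/e;q^3)_n\,q^n}{(q;q)_{2n}(q^2/e;q)_n},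 \] form a Bailey pair relative to $a=1$. (iii) The sequences with $\alpha_0=\beta_0=1$, and \[ \alpha_{3r}=(-1)^r\frac{1-q^{6r+1}}{1-q}q^{\frac{9r^2-11r}{2}}A_r\ (r\ge0),\quad \alpha_{3r+1}=0\ (r\ge0),\quad \alpha_{3r-1}=(-1)^{r+1}\frac{1-q^{6r-1}}{1-q}q^{\frac{9r^2-17r}{2}+1}B_r\ (r\ge1), \] \[ \beta_n=K_2(n)\frac{(q^2/e;q^3)_n}{(q;q)_{2n}(q^2/e;q)_n}, \] form a Bailey pair relative to $a=q$.
   Context: Notation: $(x;q)_n=\prod_{k=0}^{n-1}(1-xq^k)$ and $(x_1,\dots,x_k;q)_n=(x_1;q)_n\cdots(x_k;q)_n$. A pair of sequences $(\alpha_n)_{n\ge0},(\beta_n)_{n\ge0}$ is a Bailey pair relative to $a$ if $\alpha_0=1$ and $\beta_n=\sum_{j=0}^{n}\frac{\alpha_j}{(q;q)_{n-j}(aq;q)_{n+j}}$ for all $n\ge0$. The function $K$: for complex $a,b,c,d,e,u,v$ and a base $p$, let $\sigma_1,\dots,\sigma_4$ be the elementary symmetric functions of $b,c,d,e$ and \[ K(a,b,c,d,e,u,v,p):=\frac{uv(\sigma_3-a\sigma_1)(p\sigma_3-a\sigma_1)a^2+(1-p)uv(a^2-\sigma_4)(a^2-\sigma_2a+\sigma_4)a+(u+v)(a+uv)(\sigma_3-a\sigma_1)(a^2-p\sigma_4)a+(u^2+a)(v^2+a)(a^2-\sigma_4)(a^2-p\sigma_4)}{(a^2-bcde)(a^2-bcde\,p)(1-u)(a-u)(1-v)(a-v)}.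 \] *)

theory Defs
  imports Complex_Main
begin

definition qpoch :: "complex \<Rightarrow> complex \<Rightarrow> nat \<Rightarrow> complex" where
  "qpoch x q n = (\<Prod>k<n. 1 - x * q ^ k)"

definition qpochs :: "complex list \<Rightarrow> complex \<Rightarrow> nat \<Rightarrow> complex" where
  "qpochs xs q n = (\<Prod>x\<leftarrow>xs. qpoch x q n)"

definition bailey_pair :: "complex \<Rightarrow> complex \<Rightarrow> (nat \<Rightarrow> complex) \<Rightarrow> (nat \<Rightarrow> complex) \<Rightarrow> bool" where
  "bailey_pair q a \<alpha> \<beta> \<longleftrightarrow>
     \<alpha> 0 = 1 \<and>
     (\<forall>n. \<beta> n = (\<Sum>j\<le>n. \<alpha> j / (qpoch q q (n - j) * qpoch (a * q) q (n + j))))"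

definition K_fun ::
  "complex \<Rightarrow> complex \<Rightarrow> complex \<Rightarrow> complex \<Rightarrow> complex \<Rightarrow> complex \<Rightarrow> complex \<Rightarrow> complex \<Rightarrow> complex" where
  "K_fun a b c d e u v p =
    (let s1 = b + c + d + e;
         s2 = b * c + b * d + b * e + c * d + c * e + d * e;
         s3 = b * c * d + b * c * e + b * d * e + c * d * e;
         s4 = b * c * d * e
     in (u * v * (s3 - a * s1) * (p * s3 - a * s1) * a\<^sup>2
          + (1 - p) * u * v * (a\<^sup>2 - s4) * (a\<^sup>2 - s2 * a + s4) * a
          + (u + v) * (a + u * v) * (s3 - a * s1) * (a\<^sup>2 - p * s4) * a
          + (u\<^sup>2 + a) * (v\<^sup>2 + a) * (a\<^sup>2 - s4) * (a\<^sup>2 - p * s4))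
        / ((a\<^sup>2 - b * c * d * e) * (a\<^sup>2 - b * c * d * e * p)
          * (1 - u) * (a - u) * (1 - v) * (a - v)))"

definition K2 :: "complex \<Rightarrow> complex \<Rightarrow> complex \<Rightarrow> complex \<Rightarrow> nat \<Rightarrow> complex" where
  "K2 e u v q n =
     K_fun q (q powi (- int n)) (q powi (1 - int n)) (q powi (2 - int n)) e u v (q ^ 3)"

definition A_seq :: "complex \<Rightarrow> complex \<Rightarrow> complex \<Rightarrow> complex \<Rightarrow> nat \<Rightarrow> complex" where
  "A_seq e u v q r =
     qpochs [e, q ^ 3 * u, q ^ 3 * v, q ^ 4 / u, q ^ 4 / v] (q ^ 3) r
     / (qpochs [q ^ 4 / e, u, v, q / u, q / v] (q ^ 3) r * e ^ r)"

definition B_seq :: "complex \<Rightarrow> complex \<Rightarrow> complex \<Rightarrow> complex \<Rightarrow> nat \<Rightarrow> complex" where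
  "B_seq e u v q r =
     qpochs [e / q, q\<^sup>2 * u, q\<^sup>2 * v, q ^ 3 / u, q ^ 3 / v] (q ^ 3) r
     / (qpochs [q ^ 3 / e, u / q, v / q, 1 / u, 1 / v] (q ^ 3) r * e ^ r)"

text \<open>
  The closed form of \<open>\<beta>\<^sub>n\<close> built from \<open>K2\<close> takes the prescribed value \<open>\<beta>\<^sub>0 = 1\<close> wherever it is
  defined at \<open>n = 0\<close>; there it has the extra denominator \<open>1 - q\<^sup>4 e\<close>, absent for \<open>n \<ge> 1\<close>.
\<close>

lemma K2_0:
  assumes "q \<noteq> 0" "1 - q * e \<noteq> 0" "1 - q ^ 4 * e \<noteq> 0"
    and "u \<noteq> 1" "v \<noteq> 1" "u \<noteq> q" "v \<noteq> q"
  shows "K2 e u v q 0 = 1"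
proof -
  have d1: "q\<^sup>2 - 1 * q * q\<^sup>2 * e = q\<^sup>2 * (1 - q * e)"
    by algebra
  have d2: "q\<^sup>2 - 1 * q * q\<^sup>2 * e * q ^ 3 = q\<^sup>2 * (1 - q ^ 4 * e)"
    by algebra
  have "(q\<^sup>2 - 1 * q * q\<^sup>2 * e) * (q\<^sup>2 - 1 * q * q\<^sup>2 * e * q ^ 3)
          * (1 - u) * (q - u) * (1 - v) * (q - v) \<noteq> 0"
    unfolding d1 d2 using assms by simp
  then show ?thesis
    unfolding K2_def K_fun_def Let_def
    apply (simp only: of_nat_0 minus_zero power_int_0_right diff_zero power_int_1_right power_int_numeral)
    apply (subst divide_eq_1_iff)
    apply (rule conjI, assumption)
    apply algebra
    done
qed

end

theory Submission
  imports Defs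
begin

text \<open>
  With \<open>B\<^sub>r\<close> read as \<open>A\<close> at \<open>-r\<close>, each of the three Bailey sums collapses to one bilateral very-well-poised
  sum in base \<open>p = q\<^sup>3\<close> with \<open>a = q\<close> and parameters \<open>q\<^sup>-\<^sup>n, q\<^sup>1\<^sup>-\<^sup>n, q\<^sup>2\<^sup>-\<^sup>n, e\<close> (for part (ii) times \<open>q\<^sup>n\<close>).
  Writing \<open>x = p\<^sup>r\<close> and \<open>Y = 1/x + a x\<close>, the factors involving \<open>u\<close> and \<open>v\<close> are, up to \<open>x\<^sup>2\<close> and normalisation,
  \<open>(Y - u - a/u) (Y - v - a/v)\<close>, so only the moments of \<open>Y\<close> of order 0, 1 and 2 are needed. Two telescoping
  sums express the moments of order 1 and 2 through the one of order 0, which produces \<open>K\<close>. Passing from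
  \<open>n + 1\<close> to \<open>n\<close> multiplies the summand by a linear polynomial in \<open>Y\<close>, so the first of these relations also gives
  a first-order recurrence in \<open>n\<close> for the moment of order 0, and hence its product form.
\<close>

section \<open>Sums over symmetric ranges of integers\<close>

lemma telescope_int:
  fixes H :: "int \<Rightarrow> complex"
  shows "(\<Sum>r\<in>{- int N..int N}. H r - H (r + 1)) = H (- int N) - H (int N + 1)"
proof (induction N)
  case (Suc N)
  have "{- int (Suc N)..int (Suc N)} = insert (- int (Suc N)) (insert (int (Suc N)) {- int N..int N})"
    by auto
  then show ?case using Suc by (simp add: algebra_simps)
qed simp

text \<open>Each block of three indices around \<open>3 * r\<close> carries the two bilateral terms
  at \<open>r\<close> and \<open>- r\<close>. The block around 0 has only the indices 0 and 1, so it
  is treated apart and carries the single term \<open>g 0\<close>.\<close>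

lemma sum_blocks:
  fixes f :: "nat \<Rightarrow> complex" and g :: "int \<Rightarrow> complex"
  assumes "f 0 + f 1 = g 0"
    and "\<And>r. 1 \<le> r \<Longrightarrow> f (3 * r - 1) + f (3 * r) + f (3 * r + 1) = g (int r) + g (- int r)"
  shows "(\<Sum>j\<le>3 * N + 1. f j) = (\<Sum>r\<in>{- int N..int N}. g r)"
proof (induction N)
  case 0
  then show ?case using assms(1) by simp
next
  case (Suc N)
  have "{- int (Suc N)..int (Suc N)} = insert (- int (Suc N)) (insert (int (Suc N)) {- int N..int N})"
    by auto
  then have R: "(\<Sum>r\<in>{- int (Suc N)..int (Suc N)}. g r)
      = (g (int (Suc N)) + g (- int (Suc N))) + (\<Sum>r\<in>{- int N..int N}. g r)" by simp
  have "3 * Suc N + 1 = Suc (Suc (Suc (3 * N + 1)))" "3 * Suc N - 1 = Suc (3 * N + 1)"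
    "3 * Suc N = Suc (Suc (3 * N + 1))" by auto
  then have "(\<Sum>j\<le>3 * Suc N + 1. f j)
     = (f (3 * Suc N - 1) + f (3 * Suc N) + f (3 * Suc N + 1)) + (\<Sum>j\<le>3 * N + 1. f j)"
    by (simp only: sum.atMost_Suc) (simp add: add_ac)
  also have "\<dots> = (g (int (Suc N)) + g (- int (Suc N))) + (\<Sum>r\<in>{- int N..int N}. g r)"
    unfolding Suc by (subst assms(2)) auto
  finally show ?case unfolding R .
qed

section \<open>Moments of a terminating well-poised bilateral sum\<close>

text \<open>The hypothesis \<open>rec\<close> rewrites \<open>\<tau> (r + 1) * P (x (r + 1))\<close>
  through \<open>R (x r)\<close>, so each difference of \<open>H1\<close> or \<open>H2\<close> is
  \<open>\<tau> r\<close> times an explicit expression in \<open>x r\<close>. For nonzero a*y one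
  has P(y) = (a*y)^4 R(1/(a*y)); this symmetry forces the factor
  \<open>1 - a * (x r)\<^sup>2\<close>. The zeros in \<open>bd\<close> sit exactly at the two
  indices that telescoping leaves.\<close>

lemma well_poised_moments:
  fixes \<tau> x :: "int \<Rightarrow> complex" and a b c d e p :: complex and N :: nat
  assumes x: "\<And>r. x (r + 1) = p * x r" "\<And>r. x r \<noteq> 0" and p: "p \<noteq> 0"
    and rec: "\<And>r. \<tau> (r + 1) * ((b - a * p * x r) * (c - a * p * x r) * (d - a * p * x r) * (e - a * p * x r))
        = a\<^sup>2 * p * \<tau> r * ((1 - b * x r) * (1 - c * x r) * (1 - d * x r) * (1 - e * x r))"
    and bd: "\<tau> (- int N) = 0" "\<tau> (int N + 1) = 0"
  defines "s1 \<equiv> b + c + d + e"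
    and "s2 \<equiv> b * c + b * d + b * e + c * d + c * e + d * e"
    and "s3 \<equiv> b * c * d + b * c * e + b * d * e + c * d * e"
    and "s4 \<equiv> b * c * d * e"
    and "M \<equiv> \<lambda>k::nat. \<Sum>r\<in>{- int N..int N}. \<tau> r * (1 - a * (x r)\<^sup>2) * (1 / x r + a * x r) ^ k"
  shows "(s4 - a\<^sup>2) * M 1 = a * (s3 - a * s1) * M 0"
    and "(p * s4 - a\<^sup>2) * M 2 + a * (a * s1 - p * s3) * M 1
           + (1 - p) * a * (a\<^sup>2 - s2 * a + s4) * M 0 = 0"
proof -
  define P where "P = (\<lambda>y. (b - a * y) * (c - a * y) * (d - a * y) * (e - a * y))"
  \<comment> \<open>The factors \<open>1/x\<close> and \<open>(p/x + a x)/x\<close> make the differences of \<open>H1\<close> and \<open>H2\<close>, divided by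
    \<open>\<tau> r * (1 - a x\<^sup>2)\<close>, invariant under \<open>x \<mapsto> 1/(a x)\<close>, hence polynomials in \<open>1/x + a x\<close>.\<close>
  define H1 where "H1 = (\<lambda>r. \<tau> r * P (x r) / x r)"
  define H2 where "H2 = (\<lambda>r. \<tau> r * P (x r) * (p / x r + a * x r) / x r)"
  define R where "R = (\<lambda>y. (1 - b * y) * (1 - c * y) * (1 - d * y) * (1 - e * y))"
  have P: "P y = s4 - a * s3 * y + a\<^sup>2 * s2 * y\<^sup>2 - a ^ 3 * s1 * y ^ 3 + a ^ 4 * y ^ 4"
    and R: "R y = 1 - s1 * y + s2 * y\<^sup>2 - s3 * y ^ 3 + s4 * y ^ 4" for y
    unfolding P_def R_def s1_def s2_def s3_def s4_def
    by (simp_all add: algebra_simps power2_eq_square power3_eq_cube power4_eq_xxxx)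
  have rec': "\<tau> (r + 1) * P (x (r + 1)) = a\<^sup>2 * p * \<tau> r * R (x r)" for r
    using rec[of r] by (simp add: P_def R_def x(1) mult_ac)
  have d1: "H1 r - H1 (r + 1) = (s4 - a\<^sup>2) * (\<tau> r * (1 - a * (x r)\<^sup>2) * (1 / x r + a * x r) ^ 1)
      - a * (s3 - a * s1) * (\<tau> r * (1 - a * (x r)\<^sup>2) * (1 / x r + a * x r) ^ 0)" for r
  proof -
    have "H1 (r + 1) = a\<^sup>2 * \<tau> r * R (x r) / x r"
      unfolding H1_def rec' using p by (simp add: x(1))
    then have "H1 r - H1 (r + 1) = \<tau> r * (P (x r) - a\<^sup>2 * R (x r)) / x r"
      by (simp add: H1_def algebra_simps diff_divide_distrib)
    also have "P (x r) - a\<^sup>2 * R (x r)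
       = (1 - a * (x r)\<^sup>2) * ((s4 - a\<^sup>2) * (1 + a * (x r)\<^sup>2) - a * (s3 - a * s1) * x r)"
      unfolding P R by algebra
    also have "\<tau> r * \<dots> / x r = (s4 - a\<^sup>2) * (\<tau> r * (1 - a * (x r)\<^sup>2) * (1 / x r + a * x r) ^ 1)
      - a * (s3 - a * s1) * (\<tau> r * (1 - a * (x r)\<^sup>2) * (1 / x r + a * x r) ^ 0)"
      using x(2)[of r] by (simp add: divide_simps) (simp add: algebra_simps power2_eq_square)
    finally show ?thesis .
  qed
  have d2: "H2 r - H2 (r + 1) = (p * s4 - a\<^sup>2) * (\<tau> r * (1 - a * (x r)\<^sup>2) * (1 / x r + a * x r) ^ 2)
      + a * (a * s1 - p * s3) * (\<tau> r * (1 - a * (x r)\<^sup>2) * (1 / x r + a * x r) ^ 1)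
      + (1 - p) * a * (a\<^sup>2 - s2 * a + s4) * (\<tau> r * (1 - a * (x r)\<^sup>2) * (1 / x r + a * x r) ^ 0)" for r
  proof -
    define y where "y = x r"
    have y: "y \<noteq> 0" using x(2) y_def by simp
    have Y: "(1 / y + a * y) * y = 1 + a * y\<^sup>2" using y by (simp add: field_simps power2_eq_square)
    have "H2 (r + 1) = a\<^sup>2 * \<tau> r * R y * (1 / y + a * p * y) / y"
      unfolding H2_def rec' using p by (simp add: x(1) y_def)
    moreover have H2r: "H2 r = \<tau> r * P y * (p / y + a * y) / y"
      by (simp add: H2_def y_def)
    ultimately have "(H2 r - H2 (r + 1)) * y\<^sup>2 = \<tau> r * (P y * (p + a * y\<^sup>2) - a\<^sup>2 * R y * (1 + a * p * y\<^sup>2))"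
      using y by (simp add: field_simps power2_eq_square)
    also have "P y * (p + a * y\<^sup>2) - a\<^sup>2 * R y * (1 + a * p * y\<^sup>2)
       = (1 - a * y\<^sup>2) * ((p * s4 - a\<^sup>2) * (1 + a * y\<^sup>2)\<^sup>2 + a * (a * s1 - p * s3) * (1 + a * y\<^sup>2) * y
            + (1 - p) * a * (a\<^sup>2 - s2 * a + s4) * y\<^sup>2)"
      unfolding P R by algebra
    \<comment> \<open>Reading \<open>Y\<close> from right to left replaces each 1 + a*y^2 by y times
      the moment variable.\<close>
    also have "\<tau> r * \<dots> = ((p * s4 - a\<^sup>2) * (\<tau> r * (1 - a * y\<^sup>2) * (1 / y + a * y) ^ 2)
      + a * (a * s1 - p * s3) * (\<tau> r * (1 - a * y\<^sup>2) * (1 / y + a * y) ^ 1)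
      + (1 - p) * a * (a\<^sup>2 - s2 * a + s4) * (\<tau> r * (1 - a * y\<^sup>2) * (1 / y + a * y) ^ 0)) * y\<^sup>2"
      unfolding Y[symmetric] by (simp add: algebra_simps power2_eq_square)
    finally show ?thesis using y by (simp add: y_def[symmetric])
  qed
  have "(\<Sum>r\<in>{- int N..int N}. H1 r - H1 (r + 1)) = 0"
    unfolding telescope_int using bd by (simp add: H1_def)
  then show "(s4 - a\<^sup>2) * M 1 = a * (s3 - a * s1) * M 0"
    unfolding d1 sum_subtractf sum_distrib_left[symmetric] M_def by simp
  have "(\<Sum>r\<in>{- int N..int N}. H2 r - H2 (r + 1)) = 0"
    unfolding telescope_int using bd by (simp add: H2_def)
  then show "(p * s4 - a\<^sup>2) * M 2 + a * (a * s1 - p * s3) * M 1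
           + (1 - p) * a * (a\<^sup>2 - s2 * a + s4) * M 0 = 0"
    unfolding d2 sum.distrib sum_distrib_left[symmetric] M_def by simp
qed

text \<open>The numerator on the left is the moment of (Y - u - a/u)(Y - v - a/v), and the
  denominator is the same product at x = 1, where Y = 1 + a. Solving the two relations for
  \<open>M1\<close> and \<open>M2\<close> in terms of \<open>M0\<close> produces the numerator of
  K.\<close>

lemma K_fun_moments:
  fixes a b c d e p u v M0 M1 M2 :: complex
  defines "s1 \<equiv> b + c + d + e"
    and "s2 \<equiv> b * c + b * d + b * e + c * d + c * e + d * e"
    and "s3 \<equiv> b * c * d + b * c * e + b * d * e + c * d * e"
    and "s4 \<equiv> b * c * d * e"
  assumes m: "(s4 - a\<^sup>2) * M1 = a * (s3 - a * s1) * M0"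
    "(p * s4 - a\<^sup>2) * M2 + a * (a * s1 - p * s3) * M1 + (1 - p) * a * (a\<^sup>2 - s2 * a + s4) * M0 = 0"
    and nz: "a\<^sup>2 - s4 \<noteq> 0" "a\<^sup>2 - s4 * p \<noteq> 0" "u \<noteq> 0" "v \<noteq> 0" "u \<noteq> 1" "v \<noteq> 1" "u \<noteq> a" "v \<noteq> a"
  shows "(M2 - ((u + a / u) + (v + a / v)) * M1 + (u + a / u) * (v + a / v) * M0)
     / ((1 + a - (u + a / u)) * (1 + a - (v + a / v))) = K_fun a b c d e u v p * M0"
proof -
  define num where "num = u * v * (s3 - a * s1) * (p * s3 - a * s1) * a\<^sup>2
          + (1 - p) * u * v * (a\<^sup>2 - s4) * (a\<^sup>2 - s2 * a + s4) * a
          + (u + v) * (a + u * v) * (s3 - a * s1) * (a\<^sup>2 - p * s4) * a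
          + (u\<^sup>2 + a) * (v\<^sup>2 + a) * (a\<^sup>2 - s4) * (a\<^sup>2 - p * s4)"
  define D where "D = (a\<^sup>2 - s4) * (a\<^sup>2 - s4 * p)"
  define L where "L = (1 - u) * (a - u) * (1 - v) * (a - v)"
  define S where "S = u * v * M2 - (u + v) * (a + u * v) * M1 + (u\<^sup>2 + a) * (v\<^sup>2 + a) * M0"
  have K: "K_fun a b c d e u v p = num / (D * L)"
    unfolding K_fun_def Let_def num_def D_def L_def s1_def s2_def s3_def s4_def by (simp add: mult_ac)
  have L: "(1 + a - (u + a / u)) * (1 + a - (v + a / v)) = L / (u * v)"
  proof -
    have "1 + a - (w + a / w) = - ((1 - w) * (a - w)) / w" if "w \<noteq> 0" for w
      using that by (simp add: field_simps)
    then show ?thesis using nz by (simp add: L_def mult_ac)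
  qed
  have S: "M2 - ((u + a / u) + (v + a / v)) * M1 + (u + a / u) * (v + a / v) * M0 = S / (u * v)"
  proof -
    have w: "w + a / w = (w\<^sup>2 + a) / w" if "w \<noteq> 0" for w
      using that by (simp add: field_simps power2_eq_square)
    have "(u\<^sup>2 + a) / u + (v\<^sup>2 + a) / v = (u + v) * (a + u * v) / (u * v)"
      using nz by (simp add: field_simps power2_eq_square)
    then have "M2 - ((u + a / u) + (v + a / v)) * M1 + (u + a / u) * (v + a / v) * M0
        = M2 - (u + v) * (a + u * v) / (u * v) * M1 + (u\<^sup>2 + a) / u * ((v\<^sup>2 + a) / v) * M0"
      unfolding w[OF nz(3)] w[OF nz(4)] by simp
    also have "\<dots> = S / (u * v)"
      using nz(3,4) by (simp add: S_def divide_simps)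
    finally show ?thesis .
  qed
  have "D * S = num * M0"
  proof -
    have m1: "(a\<^sup>2 - s4) * M1 = - (a * (s3 - a * s1) * M0)"
      using m(1) by (simp add: algebra_simps)
    have m2: "(a\<^sup>2 - s4 * p) * M2 = a * (a * s1 - p * s3) * M1 + (1 - p) * a * (a\<^sup>2 - s2 * a + s4) * M0"
      using m(2) by (simp add: algebra_simps)
    \<comment> \<open>Multiplying by both denominators in \<open>D\<close> lets \<open>m2\<close>
      eliminate \<open>M2\<close> and then \<open>m1\<close> eliminate \<open>M1\<close> without any
      division.\<close>
    have "D * S = u * v * (a\<^sup>2 - s4) * ((a\<^sup>2 - s4 * p) * M2)
        - (u + v) * (a + u * v) * (a\<^sup>2 - s4 * p) * ((a\<^sup>2 - s4) * M1) + (u\<^sup>2 + a) * (v\<^sup>2 + a) * D * M0"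
      unfolding D_def S_def by (simp add: algebra_simps)
    also have "\<dots> = u * v * a * (a * s1 - p * s3) * ((a\<^sup>2 - s4) * M1)
        + u * v * (a\<^sup>2 - s4) * ((1 - p) * a * (a\<^sup>2 - s2 * a + s4) * M0)
        - (u + v) * (a + u * v) * (a\<^sup>2 - s4 * p) * ((a\<^sup>2 - s4) * M1) + (u\<^sup>2 + a) * (v\<^sup>2 + a) * D * M0"
      unfolding m2 by (simp add: algebra_simps)
    also have "\<dots> = num * M0"
      unfolding m1 D_def num_def by algebra
    finally show ?thesis .
  qed
  moreover have "D \<noteq> 0" "L \<noteq> 0" using nz by (auto simp: D_def L_def)
  ultimately have "S / L = num / (D * L) * M0" by (simp add: field_simps)
  then show ?thesis unfolding K L S using nz by simp
qed

section \<open>Shifted factorials, reciprocal q-factorials and the weight in e\<close>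

lemma qpoch_0 [simp]: "qpoch x q 0 = 1"
  by (simp add: qpoch_def)

lemma qpoch_Suc: "qpoch x q (Suc n) = qpoch x q n * (1 - x * q ^ n)"
  by (simp add: qpoch_def)

text \<open>Both sides are the product of the first n + 1 factors. The resulting quotient (1 - x
  q^n)/(1 - x) is how \<open>u\<close> and \<open>v\<close> later become linear factors in
  Y.\<close>

lemma qpoch_shift: "qpoch (q * x) q n * (1 - x) = qpoch x q n * (1 - x * q ^ n)"
proof (induction n)
  case (Suc n)
  have "qpoch (q * x) q (Suc n) * (1 - x) = (qpoch (q * x) q n * (1 - x)) * (1 - x * q ^ Suc n)"
    by (simp add: qpoch_Suc mult_ac)
  then show ?case unfolding Suc qpoch_Suc by (simp add: mult_ac)
qed simp

text \<open>The value 0 at negative arguments is the usual convention for 1/(q;q)_m. It makes the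
  bilateral sums finite and lets the step relation hold for every integer.\<close>

definition inv_qfact :: "complex \<Rightarrow> int \<Rightarrow> complex" where
  "inv_qfact q m = (if m < 0 then 0 else 1 / qpoch q q (nat m))"

lemma inv_qfact_of_nat: "inv_qfact q (int m) = 1 / qpoch q q m"
  by (simp add: inv_qfact_def)

lemma inv_qfact_neg: "m < 0 \<Longrightarrow> inv_qfact q m = 0"
  by (simp add: inv_qfact_def)

lemma inv_qfact_step:
  assumes "\<And>n. qpoch q q n \<noteq> 0"
  shows "inv_qfact q (m - 1) = (1 - q powi m) * inv_qfact q m"
proof (cases "m \<le> 0")
  case True
  \<comment> \<open>At m = 0 the factor 1 - q^0 vanishes, which matches the default value at
    -1.\<close>
  then show ?thesis by (cases "m = 0") (auto simp: inv_qfact_def)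
next
  case False
  then have "m = int (Suc (nat (m - 1)))" by simp
  then obtain k where k: "m = int (Suc k)" by blast
  have "1 - q ^ Suc k \<noteq> 0" using assms[of "Suc k"] by (simp add: qpoch_Suc)
  moreover have "nat (m - 1) = k" "nat m = Suc k" using k by auto
  moreover have "q powi m = q ^ Suc k" unfolding k power_int_of_nat ..
  ultimately show ?thesis using assms k False by (simp add: inv_qfact_def qpoch_Suc)
qed

text \<open>The second branch is the first one continued to negative indices by the reflection of
  (x;p)_r to (x;p)_{-r}; the power of q^4 is what remains after the quadratic powers cancel.\<close>

definition wp_weight :: "complex \<Rightarrow> complex \<Rightarrow> int \<Rightarrow> complex" where
  "wp_weight q e r =
     (if 0 \<le> r then qpoch e (q ^ 3) (nat r) / (qpoch (q ^ 4 / e) (q ^ 3) (nat r) * e ^ nat r)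
      else q ^ (4 * nat (- r)) * qpoch (e / q) (q ^ 3) (nat (- r))
             / (qpoch (q ^ 3 / e) (q ^ 3) (nat (- r)) * e ^ nat (- r)))"

text \<open>One recurrence covers both branches, which is what allows \<open>A_seq\<close> and
  \<open>B_seq\<close> to be treated as a single bilateral sequence.\<close>

lemma wp_weight_step:
  assumes nz: "q \<noteq> 0" "e \<noteq> 0"
    and A: "\<And>r. qpoch (q ^ 4 / e) (q ^ 3) r \<noteq> 0"
    and B: "\<And>r. qpoch (q ^ 3 / e) (q ^ 3) r \<noteq> 0"
  shows "wp_weight q e (r + 1) * (e - q ^ 4 * q powi (3 * r)) = wp_weight q e r * (1 - e * q powi (3 * r))"
proof (cases "0 \<le> r")
  case True
  then obtain k where k: "r = int k" using nonneg_int_cases by blast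
  have x: "q powi (3 * r) = (q ^ 3) ^ k"
    unfolding k by (simp add: power_int_def power_mult nat_mult_distrib)
  have f: "1 - q ^ 4 / e * (q ^ 3) ^ k \<noteq> 0" using A[of "Suc k"] by (simp add: qpoch_Suc)
  have r1: "nat (r + 1) = Suc k" "nat r = k" "0 \<le> r" "0 \<le> r + 1" using k by auto
  have "e - q ^ 4 * (q ^ 3) ^ k = e * (1 - q ^ 4 / e * (q ^ 3) ^ k)" using nz by (simp add: field_simps)
  then show ?thesis unfolding wp_weight_def r1 x qpoch_Suc using r1(3,4) nz A[of k] f
    by (simp add: divide_simps)
next
  case False
  then have "r = - int (Suc (nat (- r - 1)))" by simp
  then obtain k where k: "r = - int (Suc k)" by blast
  define y where "y = (q ^ 3) ^ k"
  have y: "y \<noteq> 0" using nz y_def by simp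
  have x: "q powi (3 * r) = 1 / (q ^ 3 * y)"
  proof -
    have "q powi (3 * r) = inverse (q powi (int (3 * Suc k)))"
      unfolding k power_int_minus[symmetric] by (simp add: algebra_simps)
    then show ?thesis unfolding power_int_of_nat power_mult y_def by (simp add: field_simps)
  qed
  have f: "1 - q ^ 3 / e * y \<noteq> 0" using B[of "Suc k"] by (simp add: qpoch_Suc y_def)
  \<comment> \<open>For k = 0 the index r + 1 is 0 and falls into the other branch; both formulas
    give 1 there.\<close>
  have s1: "wp_weight q e (r + 1) = q ^ (4 * k) * qpoch (e / q) (q ^ 3) k / (qpoch (q ^ 3 / e) (q ^ 3) k * e ^ k)"
  proof (cases k)
    case (Suc m)
    then have "\<not> 0 \<le> r + 1" "nat (- (r + 1)) = k" using k by auto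
    then show ?thesis by (simp add: wp_weight_def)
  qed (simp add: k wp_weight_def)
  have s0: "wp_weight q e r = q ^ (4 * k) * qpoch (e / q) (q ^ 3) k / (qpoch (q ^ 3 / e) (q ^ 3) k * e ^ k)
     * (q ^ 4 * (1 - e / q * y) / ((1 - q ^ 3 / e * y) * e))"
  proof -
    have "nat (- r) = Suc k" "\<not> 0 \<le> r" using k by auto
    moreover have "q ^ (4 * Suc k) = q ^ (4 * k) * q ^ 4" by (simp add: power_add mult_ac)
    ultimately show ?thesis
      unfolding wp_weight_def y_def by (simp add: qpoch_Suc mult_ac)
  qed
  have "e - q ^ 4 * (1 / (q ^ 3 * y)) = q ^ 4 * (1 - e / q * y) / ((1 - q ^ 3 / e * y) * e) * (1 - e * (1 / (q ^ 3 * y)))"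
  proof -
    have E: "(1 - q ^ 3 / e * y) * e = e - q ^ 3 * y" using nz by (simp add: field_simps)
    have E0: "e - q ^ 3 * y \<noteq> 0" unfolding E[symmetric] using f nz by simp
    have t1: "q ^ 4 * (1 - e / q * y) = q ^ 3 * (q - e * y)"
      using nz by (simp add: field_simps power_numeral_reduce)
    have t2: "1 - e * (1 / (q ^ 3 * y)) = - (e - q ^ 3 * y) / (q ^ 3 * y)"
      using nz y by (simp add: field_simps)
    have t3: "e - q ^ 4 * (1 / (q ^ 3 * y)) = - (q - e * y) / y"
      using nz y by (simp add: field_simps power_numeral_reduce)
    have "- w / y = q ^ 3 * w / E * (- E / (q ^ 3 * y))" if "E \<noteq> 0" for w E
      using that nz y by simp
    from this[OF E0] show ?thesis unfolding E t1 t2 t3 .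
  qed
  then show ?thesis unfolding s1 s0 x by (simp only: mult.assoc)
qed

section \<open>The bilateral sum in base q^3 and its moment of order 0\<close>

text \<open>The parameters \<open>u\<close> and \<open>v\<close> stay outside: the terms and moments
  depend on \<open>q\<close> and \<open>e\<close> only, and \<open>u\<close>, \<open>v\<close> enter
  afterwards through a quadratic polynomial in Y.\<close>

locale cubic_bailey =
  fixes q e :: complex
  assumes q_nz: "q \<noteq> 0" and e_nz: "e \<noteq> 0"
    and qq_nz: "\<And>n. qpoch q q n \<noteq> 0"
    and qe_nz: "\<And>n. qpoch (q\<^sup>2 / e) q n \<noteq> 0"
    and denA_nz: "\<And>r. qpoch (q ^ 4 / e) (q ^ 3) r \<noteq> 0"
    and denB_nz: "\<And>r. qpoch (q ^ 3 / e) (q ^ 3) r \<noteq> 0"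
begin

text \<open>This is the sequence to be used as \<open>\<tau>\<close>, without the very-well-poised
  factor. The parameters q^-n, q^(1-n), q^(2-n) in base q^3 merge into (q^-n;q)_{3r}, and their
  partners into (q^(n+2);q)_{3r}; up to sign, powers of q and constants these give the two
  reciprocal q-factorials. The halved exponent is always an integer.\<close>

definition wp_term :: "int \<Rightarrow> int \<Rightarrow> complex" where
  "wp_term n r = (- 1) powi r * q powi ((9 * r\<^sup>2 + r) div 2) * wp_weight q e r
     * inv_qfact q (n - 3 * r) * inv_qfact q (n + 3 * r + 1)"

text \<open>The range is governed by a separate \<open>N\<close> so that moments for
  \<open>n\<close> and \<open>n + 1\<close> can be compared term by term over the same
  range.\<close>

definition moment :: "nat \<Rightarrow> nat \<Rightarrow> nat \<Rightarrow> complex" where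
  "moment N n k = (\<Sum>r\<in>{- int N..int N}. wp_term (int n) r * (1 - q * (q powi (3 * r))\<^sup>2)
     * (1 / q powi (3 * r) + q * q powi (3 * r)) ^ k)"

lemmas iq_step = inv_qfact_step[OF qq_nz]

lemma powi_diff: "q powi (m - n) = q powi m / q powi n"
  using q_nz by (simp add: power_int_diff)

lemma powi_add: "q powi (m + n) = q powi m * q powi n"
  using q_nz by (simp add: power_int_add)

lemma powi_half: "m' = m + 2 * k \<Longrightarrow> q powi (m' div 2) = q powi (m div 2) * q powi k"
  by (simp add: powi_add)

text \<open>The denominators of K vanish only when \<open>e\<close> is a particular power of
  \<open>q\<close>. The exponents of at least 2 are excluded here, since they would make a factor of
  (q^2/e;q)_n zero.\<close>

lemma e_ne_power: "e \<noteq> q ^ (k + 2)"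
proof
  assume "e = q ^ (k + 2)"
  then have "1 - q\<^sup>2 / e * q ^ k = 0" using q_nz by (simp add: power2_eq_square)
  then have "qpoch (q\<^sup>2 / e) q (Suc k) = 0" by (simp add: qpoch_Suc)
  then show False using qe_nz by simp
qed

text \<open>This is the hypothesis \<open>rec\<close> for base q^3 and a = q. Raising r by one moves
  each reciprocal q-factorial by three places; the three resulting factors match b, c and d, while
  \<open>wp_weight_step\<close> accounts for e.\<close>

lemma wp_term_step:
  fixes n r :: int
  defines "b \<equiv> q powi (- n)" and "c \<equiv> q powi (1 - n)" and "d \<equiv> q powi (2 - n)" and "x \<equiv> q powi (3 * r)"
  shows "wp_term n (r + 1) * ((b - q * q ^ 3 * x) * (c - q * q ^ 3 * x) * (d - q * q ^ 3 * x) * (e - q * q ^ 3 * x))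
        = q\<^sup>2 * q ^ 3 * wp_term n r * ((1 - b * x) * (1 - c * x) * (1 - d * x) * (1 - e * x))"
proof -
  define Q where "Q = q powi n"
  have nz: "Q \<noteq> 0" "x \<noteq> 0" using q_nz by (auto simp: Q_def x_def)
  have bcd: "b = 1 / Q" "c = q / Q" "d = q\<^sup>2 / Q"
    by (simp_all add: b_def c_def d_def Q_def powi_diff power_int_minus divide_inverse)
  define i0 where "i0 = inv_qfact q (n - 3 * r)"
  define i4 where "i4 = inv_qfact q (n + 3 * r + 4)"
  have m: "inv_qfact q (n - 3 * r - 3) = (1 - Q / (x * q\<^sup>2)) * (1 - Q / (x * q)) * (1 - Q / x) * i0"
  proof -
    have "inv_qfact q (n - 3 * r - 1) = (1 - Q / x) * i0"
      unfolding iq_step i0_def by (simp add: Q_def x_def powi_diff)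
    moreover have "inv_qfact q (n - 3 * r - 2) = (1 - Q / (x * q)) * inv_qfact q (n - 3 * r - 1)"
      using iq_step[of "n - 3 * r - 1"] by (simp add: Q_def x_def powi_diff)
    moreover have "inv_qfact q (n - 3 * r - 3) = (1 - Q / (x * q\<^sup>2)) * inv_qfact q (n - 3 * r - 2)"
      using iq_step[of "n - 3 * r - 2"] by (simp add: Q_def x_def powi_diff)
    ultimately show ?thesis by simp
  qed
  \<comment> \<open>The step relation lowers the index, so the term at r is expressed through the
    one at r + 1; this avoids dividing by factors that may vanish.\<close>
  have p: "inv_qfact q (n + 3 * r + 1) = (1 - Q * x * q\<^sup>2) * (1 - Q * x * q ^ 3) * (1 - Q * x * q ^ 4) * i4"
  proof -
    have "inv_qfact q (n + 3 * r + 3) = (1 - Q * x * q ^ 4) * i4"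
      using iq_step[of "n + 3 * r + 4"] unfolding powi_add by (simp add: add_ac i4_def Q_def x_def)
    moreover have "inv_qfact q (n + 3 * r + 2) = (1 - Q * x * q ^ 3) * inv_qfact q (n + 3 * r + 3)"
      using iq_step[of "n + 3 * r + 3"] unfolding powi_add by (simp add: add_ac Q_def x_def)
    moreover have "inv_qfact q (n + 3 * r + 1) = (1 - Q * x * q\<^sup>2) * inv_qfact q (n + 3 * r + 2)"
      using iq_step[of "n + 3 * r + 2"] unfolding powi_add by (simp add: add_ac Q_def x_def)
    ultimately show ?thesis by simp
  qed
  define s where "s = (- 1) powi r * q powi ((9 * r\<^sup>2 + r) div 2)"
  \<comment> \<open>The halved exponent grows by 9r + 5, hence the factor x^3 q^5.\<close>
  have s': "(- 1) powi (r + 1) * q powi ((9 * (r + 1)\<^sup>2 + (r + 1)) div 2) = - s * (x ^ 3 * q ^ 5)"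
  proof -
    have "9 * (r + 1)\<^sup>2 + (r + 1) = 9 * r\<^sup>2 + r + 2 * (9 * r + 5)"
      by (simp add: power2_eq_square algebra_simps)
    then have "(9 * (r + 1)\<^sup>2 + (r + 1)) div 2 = (9 * r\<^sup>2 + r) div 2 + (3 * r * 3 + 5)"
      by simp
    moreover have "q powi (3 * r * 3) = x ^ 3"
      unfolding x_def power_int_mult[of q "3 * r" 3] by simp
    ultimately show ?thesis by (simp add: powi_add s_def power_int_add)
  qed
  have w: "wp_weight q e (r + 1) * (e - q * q ^ 3 * x) = wp_weight q e r * (1 - e * x)"
    using wp_weight_step[OF q_nz e_nz denA_nz denB_nz, of r]
    by (simp add: x_def power_numeral_reduce mult_ac)
  have n1: "n - 3 * (r + 1) = n - 3 * r - 3" "n + 3 * (r + 1) + 1 = n + 3 * r + 4" by auto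
  have "wp_term n (r + 1) * ((b - q * q ^ 3 * x) * (c - q * q ^ 3 * x) * (d - q * q ^ 3 * x) * (e - q * q ^ 3 * x))
     = - s * (x ^ 3 * q ^ 5) * (wp_weight q e (r + 1) * (e - q * q ^ 3 * x))
        * ((1 - Q / (x * q\<^sup>2)) * (1 - Q / (x * q)) * (1 - Q / x) * i0)
        * ((b - q * q ^ 3 * x) * (c - q * q ^ 3 * x) * (d - q * q ^ 3 * x) * i4)"
    unfolding wp_term_def n1 m s' i4_def[symmetric] by (simp only: mult_ac)
  also have "(b - q * q ^ 3 * x) * (c - q * q ^ 3 * x) * (d - q * q ^ 3 * x) * i4
      = q ^ 3 / Q ^ 3 * inv_qfact q (n + 3 * r + 1)"
  proof -
    have "b - q * q ^ 3 * x = (1 - Q * x * q ^ 4) / Q" "c - q * q ^ 3 * x = q * (1 - Q * x * q ^ 3) / Q"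
      "d - q * q ^ 3 * x = q\<^sup>2 * (1 - Q * x * q\<^sup>2) / Q"
      unfolding bcd using nz by (simp_all add: field_simps power_numeral_reduce)
    then show ?thesis unfolding p by (simp add: power_numeral_reduce mult_ac)
  qed
  also have "- s * (x ^ 3 * q ^ 5) * (wp_weight q e (r + 1) * (e - q * q ^ 3 * x))
        * ((1 - Q / (x * q\<^sup>2)) * (1 - Q / (x * q)) * (1 - Q / x) * i0)
        * (q ^ 3 / Q ^ 3 * inv_qfact q (n + 3 * r + 1))
     = q\<^sup>2 * q ^ 3 * wp_term n r * ((1 - b * x) * (1 - c * x) * (1 - d * x) * (1 - e * x))"
  proof -
    have "1 - b * x = - (x / Q) * (1 - Q / x)" "1 - c * x = - (x * q / Q) * (1 - Q / (x * q))"
      "1 - d * x = - (x * q\<^sup>2 / Q) * (1 - Q / (x * q\<^sup>2))"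
      unfolding bcd using nz q_nz by (simp_all add: field_simps)
    then show ?thesis
      unfolding w wp_term_def i0_def[symmetric] s_def[symmetric]
      by (simp add: power_numeral_reduce mult_ac)
  qed
  finally show ?thesis .
qed

text \<open>At r = -N the second reciprocal q-factorial has argument n - 3N + 1, at most 1 - 2N,
  which is negative because N is positive. At r = N + 1 the first one has a negative
  argument.\<close>

lemma wp_term_boundary:
  assumes "n \<le> N" "1 \<le> N"
  shows "wp_term (int n) (- int N) = 0" "wp_term (int n) (int N + 1) = 0"
  using assms by (simp_all add: wp_term_def inv_qfact_neg)

lemma moment_relations:
  fixes n N :: nat
  assumes "n \<le> N" "1 \<le> N"
  defines "b \<equiv> q powi (- int n)" and "c \<equiv> q powi (1 - int n)" and "d \<equiv> q powi (2 - int n)"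
  shows "(b * c * d * e - q\<^sup>2) * moment N n 1
      = q * (b * c * d + b * c * e + b * d * e + c * d * e - q * (b + c + d + e)) * moment N n 0"
    and "(q ^ 3 * (b * c * d * e) - q\<^sup>2) * moment N n 2
      + q * (q * (b + c + d + e) - q ^ 3 * (b * c * d + b * c * e + b * d * e + c * d * e)) * moment N n 1
      + (1 - q ^ 3) * q * (q\<^sup>2 - (b * c + b * d + b * e + c * d + c * e + d * e) * q + b * c * d * e)
          * moment N n 0 = 0"
proof -
  have x: "q powi (3 * (r + 1)) = q ^ 3 * q powi (3 * r)" "q powi (3 * r) \<noteq> 0" for r
    using q_nz by (simp_all add: distrib_left powi_add)
  have p: "q ^ 3 \<noteq> 0" using q_nz by simp
  note * = well_poised_moments[where x = "\<lambda>r. q powi (3 * r)" and \<tau> = "wp_term (int n)" and a = q and p = "q ^ 3"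
      and b = b and c = c and d = d and e = e and N = N,
      OF x p wp_term_step[of "int n", folded b_def c_def d_def] wp_term_boundary[OF assms(1,2)], folded moment_def]
  show "(b * c * d * e - q\<^sup>2) * moment N n 1
      = q * (b * c * d + b * c * e + b * d * e + c * d * e - q * (b + c + d + e)) * moment N n 0"
    by (rule *(1))
  show "(q ^ 3 * (b * c * d * e) - q\<^sup>2) * moment N n 2
      + q * (q * (b + c + d + e) - q ^ 3 * (b * c * d + b * c * e + b * d * e + c * d * e)) * moment N n 1
      + (1 - q ^ 3) * q * (q\<^sup>2 - (b * c + b * d + b * e + c * d + c * e + d * e) * q + b * c * d * e)
          * moment N n 0 = 0"
    by (rule *(2))
qed

text \<open>Lowering n + 1 to n multiplies each term by (1 - Q/x)(1 - qQx), which is 1 + qQ^2 - QY.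
  So the moment of order 0 at n combines those of orders 0 and 1 at n + 1, and the first moment
  relation at n + 1 removes the latter.\<close>

lemma moment_0_recurrence:
  assumes "Suc n \<le> N"
  defines "Q \<equiv> q ^ Suc n"
  shows "moment N n 0 * (q * e - Q ^ 3) = (q - Q\<^sup>2) * (1 - Q\<^sup>2) * (e - q * Q) * moment N (Suc n) 0"
proof -
  have Qnz: "Q \<noteq> 0" using q_nz by (simp add: Q_def)
  have Q: "q powi (int (Suc n)) = Q" unfolding Q_def power_int_of_nat ..
  have step: "wp_term (int n) r = wp_term (int (Suc n)) r
      * ((1 + q * Q\<^sup>2) - Q * (1 / q powi (3 * r) + q * q powi (3 * r)))" for r
  proof -
    define x where "x = q powi (3 * r)"
    have x: "x \<noteq> 0" using q_nz by (simp add: x_def)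
    have 1: "inv_qfact q (int n - 3 * r) = (1 - Q / x) * inv_qfact q (int (Suc n) - 3 * r)"
      using iq_step[of "int (Suc n) - 3 * r"] unfolding powi_diff Q by (simp add: x_def)
    have 2: "inv_qfact q (int n + 3 * r + 1) = (1 - Q * x * q) * inv_qfact q (int (Suc n) + 3 * r + 1)"
      using iq_step[of "int (Suc n) + 3 * r + 1"] unfolding powi_add Q by (simp add: x_def algebra_simps)
    have 3: "(1 + q * Q\<^sup>2) - Q * (1 / x + q * x) = (1 - Q / x) * (1 - Q * x * q)"
      using x by (simp add: field_simps power2_eq_square)
    show ?thesis unfolding wp_term_def 1 2 x_def[symmetric] 3 by (simp only: mult_ac)
  qed
  have "moment N n 0 = (1 + q * Q\<^sup>2) * moment N (Suc n) 0 - Q * moment N (Suc n) 1"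
    unfolding moment_def sum_distrib_left sum_subtractf[symmetric]
    unfolding step by (intro sum.cong refl) (simp only: power_0 power_one_right mult_1_right mult_1_left algebra_simps)
  \<comment> \<open>The first moment relation at \<open>Suc n\<close>, multiplied by Q^3 to become
    polynomial in Q.\<close>
  moreover have "(q ^ 3 * e - q\<^sup>2 * Q ^ 3) * moment N (Suc n) 1
     = q * (q ^ 3 + e * (q + q\<^sup>2 + q ^ 3) * Q - q * (1 + q + q\<^sup>2) * Q\<^sup>2 - q * e * Q ^ 3) * moment N (Suc n) 0"
  proof -
    have b: "q powi (- int (Suc n)) = 1 / Q" "q powi (1 - int (Suc n)) = q / Q" "q powi (2 - int (Suc n)) = q\<^sup>2 / Q"
      unfolding powi_diff power_int_minus Q by (simp_all add: divide_inverse)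
    have 1: "q ^ 3 * e - q\<^sup>2 * Q ^ 3 = Q ^ 3 * (1 / Q * (q / Q) * (q\<^sup>2 / Q) * e - q\<^sup>2)"
      using Qnz by (simp add: field_simps power_numeral_reduce)
    have 2: "q ^ 3 + e * (q + q\<^sup>2 + q ^ 3) * Q - q * (1 + q + q\<^sup>2) * Q\<^sup>2 - q * e * Q ^ 3
       = Q ^ 3 * (1 / Q * (q / Q) * (q\<^sup>2 / Q) + 1 / Q * (q / Q) * e + 1 / Q * (q\<^sup>2 / Q) * e + q / Q * (q\<^sup>2 / Q) * e
          - q * (1 / Q + q / Q + q\<^sup>2 / Q + e))"
      using Qnz by (simp add: field_simps power_numeral_reduce)
    show ?thesis
      unfolding 1 2 using moment_relations(1)[of "Suc n" N, unfolded b] assms(1) by simp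
  qed
  \<comment> \<open>The coefficient of the moment of order 1 is q^2 (q e - Q^3), so the extra factor
    q^2 keeps the elimination polynomial.\<close>
  ultimately have "q\<^sup>2 * (moment N n 0 * (q * e - Q ^ 3))
      = q\<^sup>2 * ((q - Q\<^sup>2) * (1 - Q\<^sup>2) * (e - q * Q) * moment N (Suc n) 0)"
    by algebra
  then show ?thesis using q_nz by simp
qed

text \<open>Induction on n with the range \<open>N\<close> fixed. The three factors in the
  recurrence are, up to powers of q and e, the new factors of (q;q)_{2n+2} and (q^2/e;q)_{n+1}, so
  they are nonzero and may be divided out.\<close>

lemma moment_0_closed_form:
  assumes "n \<le> N" "1 \<le> N"
  shows "moment N n 0 = qpoch (q\<^sup>2 / e) (q ^ 3) n / (qpoch q q (2 * n) * qpoch (q\<^sup>2 / e) q n)"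
  using assms(1)
proof (induction n)
  case 0
  \<comment> \<open>At n = 0 only r = 0 survives, and it contributes (1 - q)/(q;q)_1 = 1.\<close>
  have "wp_term 0 r = 0" if "r \<noteq> 0" for r
  proof -
    have "0 - 3 * r < 0 \<or> 0 + 3 * r + 1 < 0" using that by linarith
    then show ?thesis unfolding wp_term_def by (auto simp: inv_qfact_neg)
  qed
  then have "moment N 0 0 = (\<Sum>r\<in>{- int N..int N}. if r = 0 then wp_term 0 0 * (1 - q) else 0)"
    unfolding moment_def by (intro sum.cong) auto
  also have "\<dots> = wp_term 0 0 * (1 - q)" by simp
  also have "\<dots> = 1" using qq_nz[of 1]
    by (simp add: wp_term_def wp_weight_def inv_qfact_def qpoch_def)
  finally show ?case by simp
next
  case (Suc n)
  define Q where "Q = q ^ Suc n"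
  define C where "C = qpoch (q\<^sup>2 / e) (q ^ 3) n / (qpoch q q (2 * n) * qpoch (q\<^sup>2 / e) q n)"
  have qq: "qpoch q q (2 * Suc n) = qpoch q q (2 * n) * ((1 - Q\<^sup>2 / q) * (1 - Q\<^sup>2))"
  proof -
    have "q * q ^ (2 * n) = Q\<^sup>2 / q" "q * q ^ Suc (2 * n) = Q\<^sup>2"
      using q_nz by (simp_all add: Q_def power_mult[symmetric] power2_eq_square power_add[symmetric] mult_2)
    then show ?thesis by (simp add: qpoch_Suc mult_ac)
  qed
  have nz1: "(1 - Q\<^sup>2 / q) * (1 - Q\<^sup>2) \<noteq> 0" using qq_nz[of "2 * Suc n"] qq by auto
  have qe: "qpoch (q\<^sup>2 / e) q (Suc n) = qpoch (q\<^sup>2 / e) q n * (1 - q * Q / e)"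
    by (simp add: qpoch_Suc Q_def power2_eq_square mult_ac)
  have nz2: "1 - q * Q / e \<noteq> 0" using qe_nz[of "Suc n"] qe by auto
  have q3: "qpoch (q\<^sup>2 / e) (q ^ 3) (Suc n) = qpoch (q\<^sup>2 / e) (q ^ 3) n * (1 - Q ^ 3 / (q * e))"
  proof -
    have "q\<^sup>2 / e * (q ^ 3) ^ n = Q ^ 3 / (q * e)"
      using q_nz e_nz by (simp add: Q_def field_simps power_mult_distrib power_numeral_reduce)
    then show ?thesis by (simp add: qpoch_Suc)
  qed
  have "C * (q * e - Q ^ 3) = (q - Q\<^sup>2) * (1 - Q\<^sup>2) * (e - q * Q) * moment N (Suc n) 0"
    using moment_0_recurrence[OF Suc.prems] Suc.IH Suc.prems unfolding C_def Q_def by simp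
  moreover have "q * e - Q ^ 3 = q * e * (1 - Q ^ 3 / (q * e))"
    "q - Q\<^sup>2 = q * (1 - Q\<^sup>2 / q)" "e - q * Q = e * (1 - q * Q / e)"
    using q_nz e_nz by (simp_all add: field_simps)
  ultimately have "q * e * (C * (1 - Q ^ 3 / (q * e)))
      = q * e * (((1 - Q\<^sup>2 / q) * (1 - Q\<^sup>2)) * (1 - q * Q / e) * moment N (Suc n) 0)"
    by (simp only: mult_ac)
  then have "C * (1 - Q ^ 3 / (q * e)) = ((1 - Q\<^sup>2 / q) * (1 - Q\<^sup>2)) * (1 - q * Q / e) * moment N (Suc n) 0"
    using q_nz e_nz by simp
  then have "moment N (Suc n) 0 = C * (1 - Q ^ 3 / (q * e)) / (((1 - Q\<^sup>2 / q) * (1 - Q\<^sup>2)) * (1 - q * Q / e))"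
    using nz1 nz2 by simp
  then show ?case unfolding qq qe q3 C_def by (simp add: mult_ac)
qed

section \<open>Inserting u and v\<close>

text \<open>The denominator is the value of the u, v factors at r = 0, where Y = 1 + q; it makes
  those factors equal to 1 there.\<close>

definition uv_term :: "complex \<Rightarrow> complex \<Rightarrow> int \<Rightarrow> int \<Rightarrow> complex" where
  "uv_term u v n r = wp_term n r * (1 - q * (q powi (3 * r))\<^sup>2)
     * (((1 / q powi (3 * r) + q * q powi (3 * r)) - (u + q / u))
         * ((1 / q powi (3 * r) + q * q powi (3 * r)) - (v + q / v)))
     / ((1 + q - (u + q / u)) * (1 + q - (v + q / v)))"

text \<open>Expanding (Y - U)(Y - V) gives a combination of the moments of orders 0, 1, 2, which
  \<open>K_fun_moments\<close> turns into K times the closed form. What remains is that the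
  denominators of K do not vanish.\<close>

lemma sum_uv_term:
  assumes "1 \<le> n" "e \<noteq> 1 / q" and uv: "u \<noteq> 0" "v \<noteq> 0" "u \<noteq> 1" "v \<noteq> 1" "u \<noteq> q" "v \<noteq> q"
  shows "(\<Sum>r\<in>{- int n..int n}. uv_term u v (int n) r)
    = K2 e u v q n * qpoch (q\<^sup>2 / e) (q ^ 3) n / (qpoch q q (2 * n) * qpoch (q\<^sup>2 / e) q n)"
proof -
  define U where "U = u + q / u"
  define V where "V = v + q / v"
  define Q where "Q = q ^ n"
  have Qnz: "Q \<noteq> 0" using q_nz by (simp add: Q_def)
  define b where "b = q powi (- int n)"
  define c where "c = q powi (1 - int n)"
  define d where "d = q powi (2 - int n)"
  have "b = 1 / Q" "c = q / Q" "d = q\<^sup>2 / Q"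
    by (simp_all add: b_def c_def d_def Q_def powi_diff power_int_minus divide_inverse)
  then have s4: "b * c * d * e = q ^ 3 * e / Q ^ 3" by (simp add: power_numeral_reduce mult_ac)
  have n1: "q\<^sup>2 - b * c * d * e \<noteq> 0"
  proof
    \<comment> \<open>This would force e = q^(3n-1), an excluded power as n is at least 1.\<close>
    assume "q\<^sup>2 - b * c * d * e = 0"
    then have "q\<^sup>2 * Q ^ 3 = q\<^sup>2 * (q * e)"
      unfolding s4 using Qnz by (simp add: field_simps power_numeral_reduce)
    then have "q * e = Q ^ 3" using q_nz by simp
    also have "\<dots> = q ^ Suc ((3 * n - 3) + 2)"
      unfolding Q_def power_mult[symmetric] using assms(1) by (intro arg_cong[of _ _ "power q"]) simp
    also have "\<dots> = q * q ^ ((3 * n - 3) + 2)" by (rule power_Suc)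
    finally have "e = q ^ ((3 * n - 3) + 2)" using q_nz by (simp only: mult_cancel_left) simp
    then show False using e_ne_power by blast
  qed
  have n2: "q\<^sup>2 - b * c * d * e * q ^ 3 \<noteq> 0"
  proof
    assume "q\<^sup>2 - b * c * d * e * q ^ 3 = 0"
    then have "q\<^sup>2 * Q ^ 3 = q\<^sup>2 * (q ^ 4 * e)"
      unfolding s4 using Qnz by (simp add: field_simps power_numeral_reduce)
    then have *: "q ^ 4 * e = Q ^ 3" using q_nz by (simp only: mult_cancel_left) simp
    show False
    \<comment> \<open>Here e would be q^(3n-4). For n at least 2 this is an excluded power; for n =
      1 it is 1/q, which is where the hypothesis \<open>e \<noteq> 1 / q\<close> enters.\<close>
    proof (cases "n = 1")
      case True
      then have "q ^ 3 * (q * e) = q ^ 3 * 1" using * by (simp add: Q_def power_numeral_reduce mult_ac)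
      then have "q * e = 1" using q_nz by simp
      then show False using assms(2) q_nz by (simp add: field_simps)
    next
      case False
      have "Q ^ 3 = q ^ (4 + ((3 * n - 6) + 2))"
        unfolding Q_def power_mult[symmetric]
        using False assms(1) by (intro arg_cong[of _ _ "power q"]) simp
      then have "q ^ 4 * e = q ^ 4 * q ^ ((3 * n - 6) + 2)"
        using * unfolding power_add by simp
      then have "e = q ^ ((3 * n - 6) + 2)" using q_nz by (simp only: mult_cancel_left) simp
      then show False using e_ne_power by blast
    qed
  qed
  have "(\<Sum>r\<in>{- int n..int n}. uv_term u v (int n) r)
     = (moment n n 2 - (U + V) * moment n n 1 + U * V * moment n n 0) / ((1 + q - U) * (1 + q - V))"
    unfolding moment_def sum_distrib_left sum_subtractf[symmetric] sum.distrib[symmetric] sum_divide_distrib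
  proof (intro sum.cong refl)
    fix r
    have "w * ((Y - U) * (Y - V)) = w * Y\<^sup>2 - (U + V) * (w * Y ^ 1) + U * V * (w * Y ^ 0)" for w Y
      by (simp add: algebra_simps power2_eq_square)
    then show "uv_term u v (int n) r = (wp_term (int n) r * (1 - q * (q powi (3 * r))\<^sup>2)
          * (1 / q powi (3 * r) + q * q powi (3 * r))\<^sup>2
        - (U + V) * (wp_term (int n) r * (1 - q * (q powi (3 * r))\<^sup>2)
          * (1 / q powi (3 * r) + q * q powi (3 * r)) ^ 1)
        + U * V * (wp_term (int n) r * (1 - q * (q powi (3 * r))\<^sup>2)
          * (1 / q powi (3 * r) + q * q powi (3 * r)) ^ 0)) / ((1 + q - U) * (1 + q - V))"
      unfolding uv_term_def U_def[symmetric] V_def[symmetric] by simp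
  qed
  also have "\<dots> = K_fun q b c d e u v (q ^ 3) * moment n n 0"
    unfolding U_def V_def
    by (rule K_fun_moments[OF moment_relations[OF order_refl assms(1), folded b_def c_def d_def] n1 n2 uv])
  finally show ?thesis
    unfolding moment_0_closed_form[OF order_refl assms(1)] K2_def b_def c_def d_def by simp
qed

text \<open>Pairing u with q/u gives (1 - uX)(1 - qX/u) = X (Y - u - q/u), and likewise for v. The
  surplus X^2 is the difference between the exponents (9r^2 + r)/2 and (9r^2 - 11r)/2.\<close>

lemma uv_term_nonneg:
  assumes uv: "u \<noteq> 0" "v \<noteq> 0"
    and den: "\<And>r. qpochs [q ^ 4 / e, u, v, q / u, q / v] (q ^ 3) r \<noteq> 0"
  shows "uv_term u v n (int r) = (- 1) ^ r * q powi ((9 * (int r)\<^sup>2 - 11 * int r) div 2) * A_seq e u v q r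
     * (1 - q * (q powi (3 * int r))\<^sup>2) * inv_qfact q (n - 3 * int r) * inv_qfact q (n + 3 * int r + 1)"
proof -
  define X where "X = q powi (3 * int r)"
  have X: "X \<noteq> 0" "(q ^ 3) ^ r = X"
    using q_nz by (simp_all add: X_def power_int_mult)
  have ratio: "qpoch (q ^ 3 * y) (q ^ 3) r / qpoch y (q ^ 3) r = (1 - y * X) / (1 - y)"
    if "\<And>k. qpoch y (q ^ 3) k \<noteq> 0" for y
    using qpoch_shift[of "q ^ 3" y r] that[of r] that[of 1] unfolding X
    by (simp add: qpoch_Suc field_simps)
  have nz: "qpoch u (q ^ 3) k \<noteq> 0" "qpoch v (q ^ 3) k \<noteq> 0" "qpoch (q / u) (q ^ 3) k \<noteq> 0"
    "qpoch (q / v) (q ^ 3) k \<noteq> 0" for k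
    using den[of k] by (simp_all add: qpochs_def)
  have q4: "q ^ 4 / y = q ^ 3 * (q / y)" for y by (simp add: power_numeral_reduce)
  have "A_seq e u v q r = wp_weight q e (int r)
     * (qpoch (q ^ 3 * u) (q ^ 3) r / qpoch u (q ^ 3) r * (qpoch (q ^ 3 * (q / u)) (q ^ 3) r / qpoch (q / u) (q ^ 3) r))
     * (qpoch (q ^ 3 * v) (q ^ 3) r / qpoch v (q ^ 3) r * (qpoch (q ^ 3 * (q / v)) (q ^ 3) r / qpoch (q / v) (q ^ 3) r))"
    unfolding A_seq_def wp_weight_def qpochs_def q4[of u] q4[of v] by (simp add: mult_ac)
  also have "\<dots> = wp_weight q e (int r) * X\<^sup>2
     * (((1 / X + q * X) - (u + q / u)) * ((1 / X + q * X) - (v + q / v)))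
     / ((1 + q - (u + q / u)) * (1 + q - (v + q / v)))"
  proof -
    have "(1 - y * X) / (1 - y) * ((1 - q / y * X) / (1 - q / y))
        = X * ((1 / X + q * X) - (y + q / y)) / (1 + q - (y + q / y))" if "y \<noteq> 0" for y
    proof -
      have "(1 - y * X) * (1 - q / y * X) = X * ((1 / X + q * X) - (y + q / y))"
        "(1 - y) * (1 - q / y) = 1 + q - (y + q / y)"
        using that X(1) by (simp_all add: field_simps)
      then show ?thesis by (metis times_divide_times_eq)
    qed
    from this[OF uv(1)] this[OF uv(2)] show ?thesis
      unfolding ratio[OF nz(1)] ratio[OF nz(2)] ratio[OF nz(3)] ratio[OF nz(4)]
      by (simp add: power2_eq_square mult_ac)
  qed
  finally have A: "A_seq e u v q r = wp_weight q e (int r) * X\<^sup>2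
     * (((1 / X + q * X) - (u + q / u)) * ((1 / X + q * X) - (v + q / v)))
     / ((1 + q - (u + q / u)) * (1 + q - (v + q / v)))" .
  have s: "q powi ((9 * (int r)\<^sup>2 + int r) div 2) = q powi ((9 * (int r)\<^sup>2 - 11 * int r) div 2) * X\<^sup>2"
    using powi_half[of "9 * (int r)\<^sup>2 + int r" "9 * (int r)\<^sup>2 - 11 * int r" "3 * int r + 3 * int r"]
    unfolding powi_add[of "3 * int r"] by (simp add: X_def power2_eq_square)
  show ?thesis
    unfolding uv_term_def wp_term_def A s X_def[symmetric] by simp
qed

text \<open>At index -r the base point is 1/X, so Y = X + q/X, and the pair u/q, 1/u gives (1 -
  uX/q)(1 - X/u) = X (Y - u - q/u)/q. The 1/q cancels against the same factor at X = 1.\<close>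

lemma uv_term_neg:
  assumes uv: "u \<noteq> 0" "v \<noteq> 0"
    and den: "\<And>r. qpochs [q ^ 3 / e, u / q, v / q, 1 / u, 1 / v] (q ^ 3) r \<noteq> 0"
    and r: "1 \<le> r"
  shows "uv_term u v n (- int r)
     = (- 1) ^ (r + 1) * q powi ((9 * (int r)\<^sup>2 - 17 * int r) div 2 + 1) * B_seq e u v q r
     * (1 - (q powi (3 * int r))\<^sup>2 / q) * inv_qfact q (n + 3 * int r) * inv_qfact q (n - 3 * int r + 1)"
proof -
  define X where "X = q powi (3 * int r)"
  have X: "X \<noteq> 0" "(q ^ 3) ^ r = X"
    using q_nz by (simp_all add: X_def power_int_mult)
  have ratio: "qpoch (q ^ 3 * y) (q ^ 3) r / qpoch y (q ^ 3) r = (1 - y * X) / (1 - y)"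
    if "\<And>k. qpoch y (q ^ 3) k \<noteq> 0" for y
    using qpoch_shift[of "q ^ 3" y r] that[of r] that[of 1] unfolding X
    by (simp add: qpoch_Suc field_simps)
  have nz: "qpoch (u / q) (q ^ 3) k \<noteq> 0" "qpoch (v / q) (q ^ 3) k \<noteq> 0" "qpoch (1 / u) (q ^ 3) k \<noteq> 0"
    "qpoch (1 / v) (q ^ 3) k \<noteq> 0" for k
    using den[of k] by (simp_all add: qpochs_def)
  have q2: "q\<^sup>2 * y = q ^ 3 * (y / q)" "q ^ 3 / y = q ^ 3 * (1 / y)" for y
    using q_nz by (simp_all add: power_numeral_reduce)
  have w: "wp_weight q e (- int r) = q ^ (4 * r) * (qpoch (e / q) (q ^ 3) r / (qpoch (q ^ 3 / e) (q ^ 3) r * e ^ r))"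
    using r by (simp add: wp_weight_def)
  have "q ^ (4 * r) * B_seq e u v q r = wp_weight q e (- int r)
     * (qpoch (q ^ 3 * (u / q)) (q ^ 3) r / qpoch (u / q) (q ^ 3) r * (qpoch (q ^ 3 * (1 / u)) (q ^ 3) r / qpoch (1 / u) (q ^ 3) r))
     * (qpoch (q ^ 3 * (v / q)) (q ^ 3) r / qpoch (v / q) (q ^ 3) r * (qpoch (q ^ 3 * (1 / v)) (q ^ 3) r / qpoch (1 / v) (q ^ 3) r))"
    unfolding B_seq_def w qpochs_def q2(1)[of u] q2(1)[of v] q2(2)[of u] q2(2)[of v] by (simp add: mult_ac)
  also have "\<dots> = wp_weight q e (- int r) * X\<^sup>2
     * (((X + q / X) - (u + q / u)) * ((X + q / X) - (v + q / v)))
     / ((1 + q - (u + q / u)) * (1 + q - (v + q / v)))"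
  proof -
    have "(1 - y / q * X) / (1 - y / q) * ((1 - 1 / y * X) / (1 - 1 / y))
        = X * ((X + q / X) - (y + q / y)) / (1 + q - (y + q / y))" if "y \<noteq> 0" for y
    proof -
      have "(1 - y / q * X) * (1 - 1 / y * X) = X * ((X + q / X) - (y + q / y)) / q"
        "(1 - y / q) * (1 - 1 / y) = (1 + q - (y + q / y)) / q"
        using that X(1) q_nz by (simp_all add: field_simps)
      then show ?thesis unfolding times_divide_times_eq using q_nz by simp
    qed
    from this[OF uv(1)] this[OF uv(2)] show ?thesis
      unfolding ratio[OF nz(1)] ratio[OF nz(2)] ratio[OF nz(3)] ratio[OF nz(4)]
      by (simp add: power2_eq_square mult_ac)
  qed
  finally have B: "wp_weight q e (- int r)
     * (((X + q / X) - (u + q / u)) * ((X + q / X) - (v + q / v)))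
     / ((1 + q - (u + q / u)) * (1 + q - (v + q / v))) = q ^ (4 * r) * B_seq e u v q r / X\<^sup>2"
    using X(1) by simp
  \<comment> \<open>The power q^(4r) from the weight and the change of exponent give q^(12r) = X^4.
    Two of these powers cancel against the u, v factors, two against \<open>f\<close>.\<close>
  have s: "q powi ((9 * (- int r)\<^sup>2 + (- int r)) div 2) * q ^ (4 * r)
      = q powi ((9 * (int r)\<^sup>2 - 17 * int r) div 2) * X ^ 4"
  proof -
    have "q powi (8 * int r) * q ^ (4 * r) = q powi (8 * int r + int (4 * r))"
      unfolding powi_add power_int_of_nat ..
    also have "\<dots> = X ^ 4"
      unfolding X_def power_int_of_nat[symmetric, of _ 4] power_int_mult[symmetric] by simp
    finally show ?thesis
      using powi_half[of "9 * (- int r)\<^sup>2 + (- int r)" "9 * (int r)\<^sup>2 - 17 * int r" "8 * int r"]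
      by (simp add: mult.assoc)
  qed
  have x: "q powi (3 * (- int r)) = 1 / X" by (simp add: X_def power_int_minus divide_inverse)
  have m: "(- 1 :: complex) powi (- int r) = (- 1) ^ r" by (simp add: power_int_minus power_inverse[symmetric])
  \<comment> \<open>This rewriting supplies the extra sign and the extra factor q in the
    exponent.\<close>
  have f: "1 - q * (1 / X)\<^sup>2 = - q * (1 - X\<^sup>2 / q) / X\<^sup>2"
    using X(1) q_nz by (simp add: field_simps power2_eq_square)
  have "uv_term u v n (- int r) = (- 1) ^ r * q powi ((9 * (- int r)\<^sup>2 + (- int r)) div 2)
     * (wp_weight q e (- int r) * (((X + q / X) - (u + q / u)) * ((X + q / X) - (v + q / v)))
         / ((1 + q - (u + q / u)) * (1 + q - (v + q / v))))
     * (1 - q * (1 / X)\<^sup>2) * inv_qfact q (n + 3 * int r) * inv_qfact q (n - 3 * int r + 1)"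
    unfolding uv_term_def wp_term_def x m by (simp add: mult_ac)
  also have "\<dots> = (- 1) ^ r * (q powi ((9 * (- int r)\<^sup>2 + (- int r)) div 2) * q ^ (4 * r)) * B_seq e u v q r / X\<^sup>2
     * (- q * (1 - X\<^sup>2 / q) / X\<^sup>2) * inv_qfact q (n + 3 * int r) * inv_qfact q (n - 3 * int r + 1)"
    unfolding B f by simp
  also have "\<dots> = (- 1) ^ (r + 1) * q powi ((9 * (int r)\<^sup>2 - 17 * int r) div 2 + 1) * B_seq e u v q r
     * (1 - X\<^sup>2 / q) * inv_qfact q (n + 3 * int r) * inv_qfact q (n - 3 * int r + 1)"
    unfolding s powi_add using X(1) by (simp add: power_numeral_reduce mult_ac)
  finally show ?thesis unfolding X_def .
qed

section \<open>From the bilateral sum to Bailey pairs\<close>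

text \<open>Common frame for the three pairs: \<open>h\<close> stands for 1/(aq;q)_m and
  \<open>c\<close> for the extra factor in \<beta>, either 1 or q^n. Each pair then reduces to an
  identity for a single block of three indices.\<close>

lemma bailey_pair_from_blocks:
  fixes c :: "nat \<Rightarrow> complex"
  assumes \<alpha>: "\<alpha> 0 = 1" and \<beta>: "\<beta> 0 = 1"
    and h: "\<And>m. 1 / qpoch (a * q) q m = h m"
    and \<beta>n: "\<And>n. 1 \<le> n \<Longrightarrow> \<beta> n = (\<Sum>r\<in>{- int n..int n}. c n * uv_term u v (int n) r)"
    and zero: "\<And>n. \<alpha> 0 * inv_qfact q (int n) * h n + \<alpha> 1 * inv_qfact q (int n - 1) * h (n + 1)
        = c n * uv_term u v (int n) 0"
    and pos: "\<And>n r. 1 \<le> r \<Longrightarrow>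
        \<alpha> (3 * r - 1) * inv_qfact q (int n - 3 * int r + 1) * h (n + (3 * r - 1))
          + \<alpha> (3 * r) * inv_qfact q (int n - 3 * int r) * h (n + 3 * r)
          + \<alpha> (3 * r + 1) * inv_qfact q (int n - 3 * int r - 1) * h (n + (3 * r + 1))
        = c n * uv_term u v (int n) (int r) + c n * uv_term u v (int n) (- int r)"
  shows "bailey_pair q a \<alpha> \<beta>"
  unfolding bailey_pair_def
proof (intro conjI allI)
  fix n
  show "\<beta> n = (\<Sum>j\<le>n. \<alpha> j / (qpoch q q (n - j) * qpoch (a * q) q (n + j)))"
  proof (cases "n = 0")
    case True
    \<comment> \<open>At n = 0 the prescribed value is used, not the closed form.\<close>
    then show ?thesis using \<alpha> \<beta> by simp
  next
    case False
    define f where "f = (\<lambda>j. \<alpha> j * inv_qfact q (int n - int j) * h (n + j))"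
    have "(\<Sum>j\<le>n. \<alpha> j / (qpoch q q (n - j) * qpoch (a * q) q (n + j))) = (\<Sum>j\<le>n. f j)"
    proof (intro sum.cong refl)
      fix j assume "j \<in> {..n}"
      then have j: "int n - int j = int (n - j)" by (simp add: of_nat_diff)
      show "\<alpha> j / (qpoch q q (n - j) * qpoch (a * q) q (n + j)) = f j"
        unfolding f_def j inv_qfact_of_nat h[symmetric] by simp
    qed
    \<comment> \<open>Indices above n contribute 0 by the convention for \<open>inv_qfact\<close>,
      so the sum extends to complete blocks.\<close>
    also have "\<dots> = (\<Sum>j\<le>3 * n + 1. f j)"
    proof (rule sum.mono_neutral_left)
      show "\<forall>j\<in>{..3 * n + 1} - {..n}. f j = 0" by (simp add: f_def inv_qfact_neg)
    qed auto
    also have "\<dots> = (\<Sum>r\<in>{- int n..int n}. c n * uv_term u v (int n) r)"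
    proof (rule sum_blocks)
      show "f 0 + f 1 = c n * uv_term u v (int n) 0" using zero[of n] by (simp add: f_def)
      fix r :: nat assume r: "1 \<le> r"
      then have e: "int n - int (3 * r - 1) = int n - 3 * int r + 1"
        "int n - int (3 * r + 1) = int n - 3 * int r - 1" "int n - int (3 * r) = int n - 3 * int r"
        by (simp_all add: of_nat_diff)
      show "f (3 * r - 1) + f (3 * r) + f (3 * r + 1)
          = c n * uv_term u v (int n) (int r) + c n * uv_term u v (int n) (- int r)"
        unfolding f_def e by (rule pos[OF r])
    qed
    finally show ?thesis using \<beta>n False by simp
  qed
qed (rule \<alpha>)

end

section \<open>The three Bailey pairs\<close>

theorem theorem2p5:
  fixes e u v q :: complex
  assumes "q \<noteq> 0" "e \<noteq> 0" "u \<noteq> 0" "v \<noteq> 0"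
    and "e \<noteq> 1 / q"
    and "\<And>n. qpoch q q n \<noteq> 0"
    and "\<And>n. qpoch (q\<^sup>2 / e) q n \<noteq> 0"
    and "\<And>r. qpochs [q ^ 4 / e, u, v, q / u, q / v] (q ^ 3) r \<noteq> 0"
    and "\<And>r. qpochs [q ^ 3 / e, u / q, v / q, 1 / u, 1 / v] (q ^ 3) r \<noteq> 0"
  shows
    "(\<forall>\<alpha> \<beta>.
        \<alpha> 0 = 1 \<and> \<beta> 0 = 1 \<and>
        (\<forall>r\<ge>1. \<alpha> (3 * r) = (-1) ^ r *
            (q powi ((9 * (int r)\<^sup>2 - 11 * int r) div 2) * A_seq e u v q r
             + q powi ((9 * (int r)\<^sup>2 - 5 * int r) div 2) * B_seq e u v q r)) \<and>
        (\<forall>r. \<alpha> (3 * r + 1) = (-1) ^ (r + 1) *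
            q powi ((9 * (int r)\<^sup>2 + int r) div 2 + 1) * A_seq e u v q r) \<and>
        (\<forall>r\<ge>1. \<alpha> (3 * r - 1) = (-1) ^ (r + 1) *
            q powi ((9 * (int r)\<^sup>2 - 17 * int r) div 2 + 1) * B_seq e u v q r) \<and>
        (\<forall>n\<ge>1. \<beta> n = K2 e u v q n * qpoch (q\<^sup>2 / e) (q ^ 3) n
            / (qpoch q q (2 * n) * qpoch (q\<^sup>2 / e) q n))
        \<longrightarrow> bailey_pair q 1 \<alpha> \<beta>) \<and>
     (\<forall>\<alpha> \<beta>.
        \<alpha> 0 = 1 \<and> \<beta> 0 = 1 \<and>
        (\<forall>r\<ge>1. \<alpha> (3 * r) = (-1) ^ r *
            (q powi ((9 * (int r)\<^sup>2 - 5 * int r) div 2) * A_seq e u v q r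
             + q powi ((9 * (int r)\<^sup>2 - 11 * int r) div 2) * B_seq e u v q r)) \<and>
        (\<forall>r. \<alpha> (3 * r + 1) = (-1) ^ (r + 1) *
            q powi ((9 * (int r)\<^sup>2 - 5 * int r) div 2) * A_seq e u v q r) \<and>
        (\<forall>r\<ge>1. \<alpha> (3 * r - 1) = (-1) ^ (r + 1) *
            q powi ((9 * (int r)\<^sup>2 - 11 * int r) div 2) * B_seq e u v q r) \<and>
        (\<forall>n\<ge>1. \<beta> n = K2 e u v q n * (qpoch (q\<^sup>2 / e) (q ^ 3) n * q ^ n)
            / (qpoch q q (2 * n) * qpoch (q\<^sup>2 / e) q n))
        \<longrightarrow> bailey_pair q 1 \<alpha> \<beta>) \<and>
     (\<forall>\<alpha> \<beta>.
        \<alpha> 0 = 1 \<and> \<beta> 0 = 1 \<and>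
        (\<forall>r. \<alpha> (3 * r) = (-1) ^ r * ((1 - q ^ (6 * r + 1)) / (1 - q)) *
            q powi ((9 * (int r)\<^sup>2 - 11 * int r) div 2) * A_seq e u v q r) \<and>
        (\<forall>r. \<alpha> (3 * r + 1) = 0) \<and>
        (\<forall>r\<ge>1. \<alpha> (3 * r - 1) = (-1) ^ (r + 1) * ((1 - q ^ (6 * r - 1)) / (1 - q)) *
            q powi ((9 * (int r)\<^sup>2 - 17 * int r) div 2 + 1) * B_seq e u v q r) \<and>
        (\<forall>n\<ge>1. \<beta> n = K2 e u v q n * qpoch (q\<^sup>2 / e) (q ^ 3) n
            / (qpoch q q (2 * n) * qpoch (q\<^sup>2 / e) q n))
        \<longrightarrow> bailey_pair q q \<alpha> \<beta>)"
proof -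
  have denA: "qpoch (q ^ 4 / e) (q ^ 3) r \<noteq> 0" and denB: "qpoch (q ^ 3 / e) (q ^ 3) r \<noteq> 0" for r
    using assms(8)[of r] assms(9)[of r] by (simp_all add: qpochs_def)
  interpret cubic_bailey q e
    by unfold_locales (use assms(1,2,6,7) denA denB in auto)
  \<comment> \<open>These are the r = 1 factors 1 - u, 1 - v, 1 - q/u, 1 - q/v of the denominator of
    \<open>A_seq\<close>.\<close>
  have uv1: "u \<noteq> 1" "v \<noteq> 1" "u \<noteq> q" "v \<noteq> q"
    using assms(8)[of 1] assms(3,4) by (auto simp: qpochs_def qpoch_def)
  note S = sum_uv_term[OF _ assms(5,3,4) uv1]
  define Q where "Q = (\<lambda>n. q powi int n)"
  define X where "X = (\<lambda>r. q powi (3 * int r))"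
  \<comment> \<open>With these normalisations every \<alpha> in (i) and (ii) is a monomial in q and
    \<open>X r\<close> times \<open>sA\<close> or \<open>sB\<close>, or a sum of two such
    products.\<close>
  define sA where "sA = (\<lambda>r. (- 1) ^ r * q powi ((9 * (int r)\<^sup>2 - 11 * int r) div 2) * A_seq e u v q r)"
  define sB where "sB = (\<lambda>r. (- 1) ^ r * q powi ((9 * (int r)\<^sup>2 - 17 * int r) div 2) * B_seq e u v q r)"
  have Xnz: "X r \<noteq> 0" for r using assms(1) by (simp add: X_def)
  have X2: "q powi (6 * int r) = (X r)\<^sup>2" for r
    using powi_add[of "3 * int r" "3 * int r"] by (simp add: X_def power2_eq_square)
  have X1: "q powi (3 * int r) = X r" for r by (simp add: X_def)
  have hA1: "q powi ((9 * (int r)\<^sup>2 + int r) div 2 + 1) = q * (X r)\<^sup>2 * q powi ((9 * (int r)\<^sup>2 - 11 * int r) div 2)" for r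
    using powi_half[of "9 * (int r)\<^sup>2 + int r" "9 * (int r)\<^sup>2 - 11 * int r" "6 * int r"]
    unfolding powi_add X2 by (simp add: mult_ac)
  have hA2: "q powi ((9 * (int r)\<^sup>2 - 5 * int r) div 2) = X r * q powi ((9 * (int r)\<^sup>2 - 11 * int r) div 2)" for r
    using powi_half[of "9 * (int r)\<^sup>2 - 5 * int r" "9 * (int r)\<^sup>2 - 11 * int r" "3 * int r"]
    unfolding X1 by (simp add: mult_ac)
  have hB1: "q powi ((9 * (int r)\<^sup>2 - 5 * int r) div 2) = (X r)\<^sup>2 * q powi ((9 * (int r)\<^sup>2 - 17 * int r) div 2)" for r
    using powi_half[of "9 * (int r)\<^sup>2 - 5 * int r" "9 * (int r)\<^sup>2 - 17 * int r" "6 * int r"]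
    unfolding X2 by (simp add: mult_ac)
  have hB2: "q powi ((9 * (int r)\<^sup>2 - 11 * int r) div 2) = X r * q powi ((9 * (int r)\<^sup>2 - 17 * int r) div 2)" for r
    using powi_half[of "9 * (int r)\<^sup>2 - 11 * int r" "9 * (int r)\<^sup>2 - 17 * int r" "3 * int r"]
    unfolding X1 by (simp add: mult_ac)
  have hB3: "q powi ((9 * (int r)\<^sup>2 - 17 * int r) div 2 + 1) = q * q powi ((9 * (int r)\<^sup>2 - 17 * int r) div 2)" for r
    unfolding powi_add by simp
  have tA: "uv_term u v (int n) (int r) = sA r * (1 - q * (X r)\<^sup>2)
      * inv_qfact q (int n - 3 * int r) * inv_qfact q (int n + 3 * int r + 1)" for n r
    unfolding uv_term_nonneg[OF assms(3,4,8)] sA_def X_def ..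
  have tB: "uv_term u v (int n) (- int r) = sB r * ((X r)\<^sup>2 - q)
      * inv_qfact q (int n - 3 * int r + 1) * inv_qfact q (int n + 3 * int r)" if "1 \<le> r" for n r
  proof -
    have d: "(X r)\<^sup>2 - q = - (q * (1 - (X r)\<^sup>2 / q))" using assms(1) by (simp add: field_simps)
    show ?thesis
      unfolding uv_term_neg[OF assms(3,4,9) that] hB3 sB_def X1 d
      by (simp only: power_add power_one_right mult_minus_left mult_minus_right mult_1_left mult_ac)
  qed
  have iA: "inv_qfact q (int n + 3 * int r) = (1 - q * Q n * X r) * inv_qfact q (int n + 3 * int r + 1)"
    "inv_qfact q (int n - 3 * int r - 1) = (1 - Q n / X r) * inv_qfact q (int n - 3 * int r)" for n r
    using iq_step[of "int n + 3 * int r + 1"] iq_step[of "int n - 3 * int r"]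
    unfolding powi_add powi_diff by (simp_all add: Q_def X_def mult_ac)
  have iB: "inv_qfact q (int n + 3 * int r - 1) = (1 - Q n * X r) * inv_qfact q (int n + 3 * int r)"
    "inv_qfact q (int n - 3 * int r) = (1 - q * Q n / X r) * inv_qfact q (int n - 3 * int r + 1)" for n r
    using iq_step[of "int n + 3 * int r"] iq_step[of "int n - 3 * int r + 1"]
    unfolding powi_add powi_diff by (simp_all add: Q_def X_def mult_ac)
  \<comment> \<open>Relative to a = 1 each bilateral term is split between two neighbouring indices.
    The identities are (1 - qQX) - qX^2 (1 - Q/X) = 1 - qX^2 for (i), and X(1 - qQX) - X(1 - Q/X) =
    Q(1 - qX^2) for (ii), with analogues for \<open>sB\<close>.\<close>
  have A1: "sA r * inv_qfact q (int n - 3 * int r) * inv_qfact q (int n + 3 * int r)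
      - q * (X r)\<^sup>2 * sA r * inv_qfact q (int n - 3 * int r - 1) * inv_qfact q (int n + 3 * int r + 1)
      = uv_term u v (int n) (int r)" for n r
    unfolding iA tA using Xnz[of r] by (simp add: field_simps power2_eq_square)
  have A2: "X r * sA r * inv_qfact q (int n - 3 * int r) * inv_qfact q (int n + 3 * int r)
      - X r * sA r * inv_qfact q (int n - 3 * int r - 1) * inv_qfact q (int n + 3 * int r + 1)
      = Q n * uv_term u v (int n) (int r)" for n r
    unfolding iA tA using Xnz[of r] by (simp add: field_simps power2_eq_square)
  have B1: "(X r)\<^sup>2 * sB r * inv_qfact q (int n - 3 * int r) * inv_qfact q (int n + 3 * int r)
      - q * sB r * inv_qfact q (int n - 3 * int r + 1) * inv_qfact q (int n + 3 * int r - 1)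
      = uv_term u v (int n) (- int r)" if "1 \<le> r" for n r
    unfolding iB tB[OF that] using Xnz[of r] by (simp add: field_simps power2_eq_square)
  have B2: "X r * sB r * inv_qfact q (int n - 3 * int r) * inv_qfact q (int n + 3 * int r)
      - X r * sB r * inv_qfact q (int n - 3 * int r + 1) * inv_qfact q (int n + 3 * int r - 1)
      = Q n * uv_term u v (int n) (- int r)" if "1 \<le> r" for n r
    unfolding iB tB[OF that] using Xnz[of r] by (simp add: field_simps power2_eq_square)
  have sA0: "sA 0 = 1" by (simp add: sA_def A_seq_def qpochs_def)
  have X0: "X 0 = 1" by (simp add: X_def)
  have h1: "1 / qpoch (1 * q) q m = inv_qfact q (int m)" for m by (simp add: inv_qfact_of_nat)
  have idx: "int (n + 3 * r) = int n + 3 * int r" "int (n + (3 * r + 1)) = int n + 3 * int r + 1" for n r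
    by simp_all
  have idx': "int (n + (3 * r - 1)) = int n + 3 * int r - 1" if "1 \<le> r" for n r
    using that by (simp add: of_nat_diff)
  show ?thesis
  proof (intro conjI allI impI; elim conjE)
    fix \<alpha> \<beta> :: "nat \<Rightarrow> complex"
    assume a0: "\<alpha> 0 = 1" and b0: "\<beta> 0 = 1"
      and a3: "\<forall>r\<ge>1. \<alpha> (3 * r) = (- 1) ^ r * (q powi ((9 * (int r)\<^sup>2 - 11 * int r) div 2) * A_seq e u v q r
             + q powi ((9 * (int r)\<^sup>2 - 5 * int r) div 2) * B_seq e u v q r)"
      and a1: "\<forall>r. \<alpha> (3 * r + 1) = (- 1) ^ (r + 1) *
            q powi ((9 * (int r)\<^sup>2 + int r) div 2 + 1) * A_seq e u v q r"
      and a2: "\<forall>r\<ge>1. \<alpha> (3 * r - 1) = (- 1) ^ (r + 1) *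
            q powi ((9 * (int r)\<^sup>2 - 17 * int r) div 2 + 1) * B_seq e u v q r"
      and bn: "\<forall>n\<ge>1. \<beta> n = K2 e u v q n * qpoch (q\<^sup>2 / e) (q ^ 3) n
            / (qpoch q q (2 * n) * qpoch (q\<^sup>2 / e) q n)"
    have e3: "\<alpha> (3 * r) = sA r + (X r)\<^sup>2 * sB r" if "1 \<le> r" for r
      using a3 that hB1[of r] by (simp add: sA_def sB_def algebra_simps)
    have e1: "\<alpha> (3 * r + 1) = - (q * (X r)\<^sup>2 * sA r)" for r
      using a1[rule_format, of r] unfolding hA1 by (simp add: sA_def mult_ac)
    have e2: "\<alpha> (3 * r - 1) = - (q * sB r)" if "1 \<le> r" for r
      using a2[rule_format, OF that] unfolding hB3 by (simp add: sB_def mult_ac)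
    show "bailey_pair q 1 \<alpha> \<beta>"
    proof (rule bailey_pair_from_blocks[where c = "\<lambda>_. 1" and u = u and v = v and a = 1
          and \<alpha> = \<alpha> and \<beta> = \<beta> and h = "\<lambda>m. inv_qfact q (int m)", OF a0 b0 h1])
      show "\<beta> n = (\<Sum>r\<in>{- int n..int n}. 1 * uv_term u v (int n) r)" if "1 \<le> n" for n
        using bn that S[OF that] by simp
      show "\<alpha> 0 * inv_qfact q (int n) * inv_qfact q (int n) + \<alpha> 1 * inv_qfact q (int n - 1) * inv_qfact q (int (n + 1))
          = 1 * uv_term u v (int n) 0" for n
        using A1[of 0 n] e1[of 0] a0 sA0 X0 by (simp add: add.commute)
      show "\<alpha> (3 * r - 1) * inv_qfact q (int n - 3 * int r + 1) * inv_qfact q (int (n + (3 * r - 1)))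
          + \<alpha> (3 * r) * inv_qfact q (int n - 3 * int r) * inv_qfact q (int (n + 3 * r))
          + \<alpha> (3 * r + 1) * inv_qfact q (int n - 3 * int r - 1) * inv_qfact q (int (n + (3 * r + 1)))
        = 1 * uv_term u v (int n) (int r) + 1 * uv_term u v (int n) (- int r)" if "1 \<le> r" for n r
        unfolding e1 e2[OF that] e3[OF that] idx idx'[OF that] A1[symmetric] B1[OF that, symmetric]
        by (simp add: ring_distribs)
    qed
  next
    fix \<alpha> \<beta> :: "nat \<Rightarrow> complex"
    assume a0: "\<alpha> 0 = 1" and b0: "\<beta> 0 = 1"
      and a3: "\<forall>r\<ge>1. \<alpha> (3 * r) = (- 1) ^ r * (q powi ((9 * (int r)\<^sup>2 - 5 * int r) div 2) * A_seq e u v q r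
             + q powi ((9 * (int r)\<^sup>2 - 11 * int r) div 2) * B_seq e u v q r)"
      and a1: "\<forall>r. \<alpha> (3 * r + 1) = (- 1) ^ (r + 1) *
            q powi ((9 * (int r)\<^sup>2 - 5 * int r) div 2) * A_seq e u v q r"
      and a2: "\<forall>r\<ge>1. \<alpha> (3 * r - 1) = (- 1) ^ (r + 1) *
            q powi ((9 * (int r)\<^sup>2 - 11 * int r) div 2) * B_seq e u v q r"
      and bn: "\<forall>n\<ge>1. \<beta> n = K2 e u v q n * (qpoch (q\<^sup>2 / e) (q ^ 3) n * q ^ n)
            / (qpoch q q (2 * n) * qpoch (q\<^sup>2 / e) q n)"
    have e3: "\<alpha> (3 * r) = X r * sA r + X r * sB r" if "1 \<le> r" for r
    proof -
      have "\<alpha> (3 * r) = (- 1) ^ r * (X r * q powi ((9 * (int r)\<^sup>2 - 11 * int r) div 2) * A_seq e u v q r)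
             + (- 1) ^ r * (X r * q powi ((9 * (int r)\<^sup>2 - 17 * int r) div 2) * B_seq e u v q r)"
        unfolding a3[rule_format, OF that] hA2[symmetric] hB2[symmetric] by (simp add: distrib_left)
      then show ?thesis by (simp add: sA_def sB_def mult_ac)
    qed
    have e1: "\<alpha> (3 * r + 1) = - (X r * sA r)" for r
      using a1[rule_format, of r] unfolding hA2 by (simp add: sA_def mult_ac)
    have e2: "\<alpha> (3 * r - 1) = - (X r * sB r)" if "1 \<le> r" for r
      using a2[rule_format, OF that] unfolding hB2 by (simp add: sB_def mult_ac)
    show "bailey_pair q 1 \<alpha> \<beta>"
    proof (rule bailey_pair_from_blocks[where c = Q and u = u and v = v and a = 1
          and \<alpha> = \<alpha> and \<beta> = \<beta> and h = "\<lambda>m. inv_qfact q (int m)", OF a0 b0 h1])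
      show "\<beta> n = (\<Sum>r\<in>{- int n..int n}. Q n * uv_term u v (int n) r)" if "1 \<le> n" for n
        unfolding sum_distrib_left[symmetric] S[OF that] using bn that by (simp add: Q_def)
      show "\<alpha> 0 * inv_qfact q (int n) * inv_qfact q (int n) + \<alpha> 1 * inv_qfact q (int n - 1) * inv_qfact q (int (n + 1))
          = Q n * uv_term u v (int n) 0" for n
        using A2[of 0 n] e1[of 0] a0 sA0 X0 by (simp add: add.commute)
      show "\<alpha> (3 * r - 1) * inv_qfact q (int n - 3 * int r + 1) * inv_qfact q (int (n + (3 * r - 1)))
          + \<alpha> (3 * r) * inv_qfact q (int n - 3 * int r) * inv_qfact q (int (n + 3 * r))
          + \<alpha> (3 * r + 1) * inv_qfact q (int n - 3 * int r - 1) * inv_qfact q (int (n + (3 * r + 1)))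
        = Q n * uv_term u v (int n) (int r) + Q n * uv_term u v (int n) (- int r)" if "1 \<le> r" for n r
        unfolding e1 e2[OF that] e3[OF that] idx idx'[OF that] A2[symmetric] B2[OF that, symmetric]
        by (simp add: ring_distribs)
    qed
  next
    fix \<alpha> \<beta> :: "nat \<Rightarrow> complex"
    assume a0: "\<alpha> 0 = 1" and b0: "\<beta> 0 = 1"
      and a3: "\<forall>r. \<alpha> (3 * r) = (- 1) ^ r * ((1 - q ^ (6 * r + 1)) / (1 - q)) *
            q powi ((9 * (int r)\<^sup>2 - 11 * int r) div 2) * A_seq e u v q r"
      and a1: "\<forall>r. \<alpha> (3 * r + 1) = 0"
      and a2: "\<forall>r\<ge>1. \<alpha> (3 * r - 1) = (- 1) ^ (r + 1) * ((1 - q ^ (6 * r - 1)) / (1 - q)) *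
            q powi ((9 * (int r)\<^sup>2 - 17 * int r) div 2 + 1) * B_seq e u v q r"
      and bn: "\<forall>n\<ge>1. \<beta> n = K2 e u v q n * qpoch (q\<^sup>2 / e) (q ^ 3) n
            / (qpoch q q (2 * n) * qpoch (q\<^sup>2 / e) q n)"
    have q1: "1 - q \<noteq> 0" using assms(6)[of 1] by (simp add: qpoch_def)
    \<comment> \<open>Relative to a = q, the factor 1 - q freed here cancels the denominator of
      \<alpha>.\<close>
    have hq: "1 / qpoch (q * q) q m = (1 - q) * inv_qfact q (int m + 1)" for m
    proof -
      have "qpoch (q * q) q m * (1 - q) = qpoch q q (Suc m)"
        by (simp only: qpoch_shift qpoch_Suc)
      moreover have "inv_qfact q (int m + 1) = 1 / qpoch q q (Suc m)"
        unfolding inv_qfact_of_nat[symmetric] by (simp add: add.commute)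
      ultimately show ?thesis using q1 by (metis nonzero_mult_divide_mult_cancel_right2 times_divide_eq_right mult.commute mult_1_right)
    qed
    have X6: "q ^ (6 * r) = (X r)\<^sup>2" for r
      using X2[of r] power_int_of_nat[of q "6 * r"] by simp
    have e3: "\<alpha> (3 * r) * (1 - q) = sA r * (1 - q * (X r)\<^sup>2)" for r
      using q1 unfolding a3[rule_format] sA_def power_add X6 by (simp add: mult_ac)
    have e2: "\<alpha> (3 * r - 1) * (1 - q) = sB r * ((X r)\<^sup>2 - q)" if "1 \<le> r" for r
    proof -
      \<comment> \<open>The natural subtraction is exact since r is at least 1.\<close>
      have "q * q ^ (6 * r - 1) = (X r)\<^sup>2" unfolding X6[symmetric] power_Suc[symmetric] using that by simp
      then have "q * (1 - q ^ (6 * r - 1)) = - ((X r)\<^sup>2 - q)" by (simp add: right_diff_distrib)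
      moreover have "\<alpha> (3 * r - 1) * (1 - q) = - (sB r * (q * (1 - q ^ (6 * r - 1))))"
        using q1 unfolding a2[rule_format, OF that] hB3 sB_def by (simp add: mult_ac)
      ultimately show ?thesis by (simp only: mult_minus_right minus_minus)
    qed
    show "bailey_pair q q \<alpha> \<beta>"
    proof (rule bailey_pair_from_blocks[where c = "\<lambda>_. 1" and u = u and v = v and a = q
          and \<alpha> = \<alpha> and \<beta> = \<beta> and h = "\<lambda>m. (1 - q) * inv_qfact q (int m + 1)", OF a0 b0 hq])
      show "\<beta> n = (\<Sum>r\<in>{- int n..int n}. 1 * uv_term u v (int n) r)" if "1 \<le> n" for n
        using bn that S[OF that] by simp
      show "\<alpha> 0 * inv_qfact q (int n) * ((1 - q) * inv_qfact q (int n + 1))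
          + \<alpha> 1 * inv_qfact q (int n - 1) * ((1 - q) * inv_qfact q (int (n + 1) + 1))
          = 1 * uv_term u v (int n) 0" for n
        using tA[of n 0] a1[rule_format, of 0] a0 sA0 X0 by simp
      show "\<alpha> (3 * r - 1) * inv_qfact q (int n - 3 * int r + 1) * ((1 - q) * inv_qfact q (int (n + (3 * r - 1)) + 1))
          + \<alpha> (3 * r) * inv_qfact q (int n - 3 * int r) * ((1 - q) * inv_qfact q (int (n + 3 * r) + 1))
          + \<alpha> (3 * r + 1) * inv_qfact q (int n - 3 * int r - 1) * ((1 - q) * inv_qfact q (int (n + (3 * r + 1)) + 1))
        = 1 * uv_term u v (int n) (int r) + 1 * uv_term u v (int n) (- int r)" if "1 \<le> r" for n r
      \<comment> \<open>No splitting occurs here: index \<open>3 * r\<close> carries the term at r,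
        index \<open>3 * r - 1\<close> the term at -r, and \<open>3 * r + 1\<close> nothing.\<close>
      proof -
        have "x * i * ((1 - q) * j) = x * (1 - q) * i * j" for x i j by simp
        moreover have "int n + 3 * int r - 1 + 1 = int n + 3 * int r" by simp
        ultimately show ?thesis
          unfolding idx idx'[OF that] a1[rule_format] tA tB[OF that] e2[OF that, symmetric] e3[symmetric]
          by simp
      qed
    qed
  qed
qed

end
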